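(* Let $\mathbb{X},\mathbb{Y}$ be Banach spaces, $g:\mathbb{X}\to\mathbb{Y}$ continuously differentiable and $f:\mathbb{Y}\to\mathbb{R}\cup\{+\infty\}$ proper, lower semicontinuous and convex. Let $S_f:=\{y\in\mathbb{Y}:f(y)\le0\}$ and $\mathcal{S}:=\{x\in\mathbb{X}:f(g(x))\le0\}$, and assume ${\rm bd}(S_f)\subseteq f^{-1}(0)$. Let $\bar x\in\mathcal{S}$ be such that $g(\bar x)\in{\rm int}({\rm dom} f)$ and $g$ is metrically regular around $\bar x$. Then the inequality $(f\circ g)(x)\le0$ has a local error bound at $\bar x$ if and only if $$\limsup_{x\xrightarrow{{\rm bd}(\mathcal{S})}\bar x}\mathbf{e}\Big(\{h\in\mathbb{X}:\mathbf{d}^+f(g(x),\nabla g(x)(h))\le1\},\ \nabla g(x)^{-1}\big(\mathbf{T}^{\mathbf B}(S_f,g(x))\big)\Big)<+\infty.$$ Moreover, $$\tau(\mathcal{S},\bar x)=\limsup_{x\xrightarrow{{\rm bd}(\mathcal{S})}\bar x}\mathbf{e}\Big(\{h\in\mathbb{X}:\mathbf{d}^+f(g(x),\nabla g(x)(h))\le1\},\ \nabla g(x)^{-1}\big(\mathbf{T}^{\mathbf B}(S_f,g(x))\big)\Big).$$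
   Context: $\mathbf{B}(a,\delta)$ is the open ball with center $a$ and radius $\delta$; ${\rm bd}$, ${\rm int}$ denote boundary and interior; ${\rm dom} f=\{y:f(y)<+\infty\}$; $\mathbf{d}(x,D):=\inf\{\|x-y\|:y\in D\}$. Excess: $\mathbf{e}(C,D):=\sup_{x\in C}\mathbf{d}(x,D)$, with $\mathbf{e}(\emptyset,D)=0$ if $D\ne\emptyset$ and $=\infty$ otherwise. For convex $f$, $\mathbf{d}^+f(y,v):=\lim_{t\to0^+}\frac{f(y+tv)-f(y)}{t}$. Bouligand tangent cone $\mathbf{T}^{\mathbf B}(C,c)$: all $v$ with $v_n\to v$, $t_n\downarrow0$, $c+t_nv_n\in C$. "Continuously differentiable" means Fréchet differentiable with $x\mapsto\nabla g(x)$ continuous in operator norm. $g$ is metrically regular around $\bar x$ if there exist $\kappa>0$ and neighborhoods $U$ of $\bar x$, $V$ of $g(\bar x)$ with $\mathbf{d}(x,g^{-1}(y))\le\kappa\|g(x)-y\|$ for all $(x,y)\in U\times V$. Local error bound at $\bar x$: there exist $\tau,\delta>0$ with $\mathbf{d}(x,\mathcal{S})\le\tau\max\{f(g(x)),0\}$ for all $x\in\mathbf{B}(\bar x,\delta)$; $\tau(\mathcal{S},\bar x)$ is the infimum of all $\tau>0$ for which such a $\delta$ exists (with $\inf\emptyset=+\infty$). $\limsup_{x\xrightarrow{D}\bar x}F(x):=\lim_{\delta\downarrow0}\sup\{F(x):x\in D\cap\mathbf{B}(\bar x,\delta)\}$, with the convention $\sup\emptyset=0$. *)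

theory Defs
  imports "HOL-Analysis.Analysis"
begin

text \<open>Extended-real-valued functions f : Y -> R \<union> {+\<infinity>} are modelled as maps into ereal
  that never take the value -\<infinity> (part of properness).\<close>

definition proper_fun :: "('b \<Rightarrow> ereal) \<Rightarrow> bool" where
  "proper_fun f \<longleftrightarrow> (\<forall>y. f y \<noteq> -\<infinity>) \<and> (\<exists>y. f y \<noteq> \<infinity>)"

definition lsc_fun :: "('b::topological_space \<Rightarrow> ereal) \<Rightarrow> bool" where
  "lsc_fun f \<longleftrightarrow> (\<forall>c::ereal. closed {y. f y \<le> c})"

definition convex_fun :: "('b::real_vector \<Rightarrow> ereal) \<Rightarrow> bool" where
  "convex_fun f \<longleftrightarrow> (\<forall>x y t. 0 < t \<and> t < 1 \<longrightarrow>
      f (t *\<^sub>R x + (1 - t) *\<^sub>R y) \<le> ereal t * f x + ereal (1 - t) * f y)"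

definition edom :: "('b \<Rightarrow> ereal) \<Rightarrow> 'b set" where
  "edom f = {y. f y < \<infinity>}"

definition dir_deriv :: "('b::real_normed_vector \<Rightarrow> ereal) \<Rightarrow> 'b \<Rightarrow> 'b \<Rightarrow> ereal" where
  "dir_deriv f y v = Lim (at_right (0::real)) (\<lambda>t. (f (y + t *\<^sub>R v) - f y) / ereal t)"

definition bouligand_cone :: "'b::real_normed_vector set \<Rightarrow> 'b \<Rightarrow> 'b set" where
  "bouligand_cone C c = {v. \<exists>vs ts. vs \<longlonglongrightarrow> v \<and> ts \<longlonglongrightarrow> 0 \<and> (\<forall>n. ts n > 0)
        \<and> (\<forall>n. c + ts n *\<^sub>R vs n \<in> C)}"

definition edist_set :: "'a::metric_space \<Rightarrow> 'a set \<Rightarrow> ereal" where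
  "edist_set x D = (if D = {} then \<infinity> else ereal (infdist x D))"

definition excess :: "'a::metric_space set \<Rightarrow> 'a set \<Rightarrow> ereal" where
  "excess C D = (if D = {} then \<infinity> else if C = {} then 0
                 else (SUP x\<in>C. ereal (infdist x D)))"

text \<open>limsup_{x -> xbar, x in D} F x = lim_{delta -> 0+} sup { F x : x in D \<inter> B(xbar,delta) },
  with sup {} = 0; the inner sup is monotone in delta, so the limit is the infimum.\<close>
definition limsup_within :: "'a::metric_space set \<Rightarrow> 'a \<Rightarrow> ('a \<Rightarrow> ereal) \<Rightarrow> ereal" where
  "limsup_within D xbar F = (INF \<delta>\<in>{0<..}.
      (if D \<inter> ball xbar \<delta> = {} then 0 else (SUP x\<in>D \<inter> ball xbar \<delta>. F x)))"

definition metrically_regular_around :: "('a::metric_space \<Rightarrow> 'b::real_normed_vector) \<Rightarrow> 'a \<Rightarrow> bool" where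
  "metrically_regular_around g xbar \<longleftrightarrow> (\<exists>\<kappa>>0. \<exists>U V. open U \<and> xbar \<in> U \<and> open V \<and> g xbar \<in> V \<and>
      (\<forall>x\<in>U. \<forall>y\<in>V. edist_set x (g -` {y}) \<le> ereal (\<kappa> * norm (g x - y))))"

definition error_bound_with :: "('a::metric_space \<Rightarrow> ereal) \<Rightarrow> 'a \<Rightarrow> real \<Rightarrow> bool" where
  "error_bound_with \<phi> xbar \<tau> \<longleftrightarrow> \<tau> > 0 \<and> (\<exists>\<delta>>0. \<forall>x\<in>ball xbar \<delta>.
      edist_set x {z. \<phi> z \<le> 0} \<le> ereal \<tau> * max (\<phi> x) 0)"

definition has_local_error_bound :: "('a::metric_space \<Rightarrow> ereal) \<Rightarrow> 'a \<Rightarrow> bool" where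
  "has_local_error_bound \<phi> xbar \<longleftrightarrow> (\<exists>\<tau>. error_bound_with \<phi> xbar \<tau>)"

definition error_bound_modulus :: "('a::metric_space \<Rightarrow> ereal) \<Rightarrow> 'a \<Rightarrow> ereal" where
  "error_bound_modulus \<phi> xbar = Inf (ereal ` {\<tau>. error_bound_with \<phi> xbar \<tau>})"

end

theory Submission
  imports Defs
begin

text \<open>
  By Baire's theorem \<open>f\<close> is Lipschitz near \<open>g xbar\<close>, and metric regularity makes every \<open>g' x\<close> with \<open>x\<close>
  near \<open>xbar\<close> surjective with a linear bound on preimages.

  If \<open>\<tau>\<close> is an error bound constant and \<open>d\<^sup>+f (g x, g' x h) \<le> 1\<close> at a boundary point \<open>x\<close>, then the
  point \<open>x + t h\<close> has distance at most about \<open>\<tau> t\<close> to the solution set; rescaling a nearby solution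
  gives a vector which, after a small correction through surjectivity of \<open>g' x\<close>, lies in the preimage
  of the tangent cone and has distance at most about \<open>\<tau>\<close> to \<open>h\<close>.

  Conversely, for \<open>x\<close> outside the solution set, Ekeland's principle for \<open>u \<mapsto> \<parallel>x - u\<parallel>\<close> on the
  solution set yields a boundary point \<open>z\<close> for which \<open>x - z\<close> is almost as far from the tangent cone as
  from \<open>0\<close>. The excess bound at \<open>z\<close> then forces \<open>d\<^sup>+f (g z, g' z (x - z))\<close>, and hence by convexity
  \<open>f (g x)\<close>, to be at least about \<open>\<parallel>x - z\<parallel> / \<tau>\<close>.
\<close>

section \<open>Extended-real-valued convex functions\<close>

lemma convex_fun_le:
  assumes "convex_fun f" "f x \<le> ereal a" "f y \<le> ereal b" "0 \<le> t" "t \<le> 1"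
  shows "f (t *\<^sub>R x + (1 - t) *\<^sub>R y) \<le> ereal (t * a + (1 - t) * b)"
proof (cases "t = 0 \<or> t = 1")
  case True
  then show ?thesis using assms by auto
next
  case False
  then have t: "0 < t" "t < 1" using assms by auto
  have "f (t *\<^sub>R x + (1 - t) *\<^sub>R y) \<le> ereal t * f x + ereal (1 - t) * f y"
    using assms(1) t unfolding convex_fun_def by blast
  also have "\<dots> \<le> ereal t * ereal a + ereal (1 - t) * ereal b"
    using assms t by (intro add_mono ereal_mult_left_mono) auto
  finally show ?thesis by simp
qed

lemma convex_sublevel:
  assumes "convex_fun f"
  shows "convex {y. f y \<le> ereal c}"
  unfolding convex_alt
proof (clarsimp, goal_cases)
  case (1 x y u)
  then show ?case
    using convex_fun_le[OF assms, of y c x c u] by (simp add: algebra_simps)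
qed

text \<open>The sets \<open>G n\<close> below are symmetric under \<open>u \<mapsto> -u\<close>, so that an interior point of some \<open>G n\<close> gives by
  convexity a neighbourhood of \<open>0\<close>; scaling by \<open>1 / Suc n\<close> makes them cover the whole space.\<close>

lemma convex_fun_bounded_above_nhds:
  fixes f :: "'b::banach \<Rightarrow> ereal"
  assumes lsc: "lsc_fun f" and conv: "convex_fun f" and int: "y0 \<in> interior (edom f)"
  shows "\<exists>M. \<exists>s>0. \<forall>y\<in>ball y0 s. f y \<le> ereal M"
proof -
  define G where "G n = {u. f (y0 + (1 / real (Suc n)) *\<^sub>R u) \<le> ereal (real n) \<and>
      f (y0 - (1 / real (Suc n)) *\<^sub>R u) \<le> ereal (real n)}" for n
  have closedG: "closed (G n)" for n
  proof -
    have cl: "closed {y. f y \<le> ereal (real n)}"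
      using lsc unfolding lsc_fun_def by blast
    have "G n = (\<lambda>u. y0 + (1 / real (Suc n)) *\<^sub>R u) -` {y. f y \<le> ereal (real n)} \<inter>
      (\<lambda>u. y0 - (1 / real (Suc n)) *\<^sub>R u) -` {y. f y \<le> ereal (real n)}"
      by (auto simp: G_def)
    then show ?thesis
      using cl by (simp only:) (intro closed_Int continuous_closed_vimage continuous_intros)
  qed
  obtain \<rho> where \<rho>: "\<rho> > 0" "ball y0 \<rho> \<subseteq> edom f"
    using int by (meson mem_interior)
  have fin: "\<exists>a. f y \<le> ereal a" if "y \<in> ball y0 \<rho>" for y
  proof -
    have "f y < \<infinity>" using that \<rho> unfolding edom_def by auto
    then show ?thesis by (cases "f y") auto
  qed
  obtain a0 where a0: "f y0 \<le> ereal a0" using fin[of y0] \<rho> by auto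
  have "\<exists>n. u \<in> G n" for u
  proof -
    obtain k :: nat where k: "norm u / \<rho> < real k" using reals_Archimedean2 by blast
    have kpos: "real (Suc k) > 0" by simp
    have "norm u < \<rho> * real (Suc k)" using k \<rho> by (simp add: field_simps)
    then have nk: "norm ((1 / real (Suc k)) *\<^sub>R u) < \<rho>" by (simp add: field_simps)
    obtain a where a: "f (y0 + (1 / real (Suc k)) *\<^sub>R u) \<le> ereal a"
      using fin[of "y0 + (1 / real (Suc k)) *\<^sub>R u"] nk by (auto simp: dist_norm)
    obtain b where b: "f (y0 - (1 / real (Suc k)) *\<^sub>R u) \<le> ereal b"
      using fin[of "y0 - (1 / real (Suc k)) *\<^sub>R u"] nk by (auto simp: dist_norm)
    \<comment> \<open>\<open>k\<close> puts the two points \<open>y0\<close> +-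
      \<open>u / Suc k\<close> in the domain; \<open>n\<close> dominates \<open>k\<close> and all
      three bounds found so far.\<close>
    obtain n :: nat where n: "max (real k) (max a0 (max a b)) < real n"
      using reals_Archimedean2 by blast
    \<comment> \<open>With weight \<open>c\<close>, which is at most 1 since \<open>k < n\<close>,
      the points with step \<open>1 / Suc n\<close> are convex combinations of those with step
      \<open>1 / Suc k\<close> and \<open>y0\<close>.\<close>
    define c where "c = real (Suc k) / real (Suc n)"
    have c: "0 \<le> c" "c \<le> 1" using n by (auto simp: c_def)
    have "f (c *\<^sub>R (y0 + (1 / real (Suc k)) *\<^sub>R u) + (1 - c) *\<^sub>R y0) \<le> ereal (c * real n + (1 - c) * real n)"
      using a a0 n c by (intro convex_fun_le[OF conv]) (auto intro: order_trans)
    moreover have "f (c *\<^sub>R (y0 - (1 / real (Suc k)) *\<^sub>R u) + (1 - c) *\<^sub>R y0) \<le> ereal (c * real n + (1 - c) * real n)"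
      using b a0 n c by (intro convex_fun_le[OF conv]) (auto intro: order_trans)
    moreover have "c *\<^sub>R (y0 + (1 / real (Suc k)) *\<^sub>R u) + (1 - c) *\<^sub>R y0 = y0 + (1 / real (Suc n)) *\<^sub>R u"
      by (simp add: c_def algebra_simps)
    moreover have "c *\<^sub>R (y0 - (1 / real (Suc k)) *\<^sub>R u) + (1 - c) *\<^sub>R y0 = y0 - (1 / real (Suc n)) *\<^sub>R u"
      by (simp add: c_def algebra_simps)
    moreover have "c * real n + (1 - c) * real n = real n" by (simp add: algebra_simps)
    ultimately have "u \<in> G n" by (simp add: G_def)
    then show ?thesis by blast
  qed
  then have UG: "\<Union>(range G) = UNIV" by blast
  \<comment> \<open>Baire: countably many closed sets with empty interior cannot cover a complete
    space.\<close>
  have "\<exists>n. interior (G n) \<noteq> {}"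
  proof (rule ccontr)
    assume "\<not> ?thesis"
    then have "euclidean interior_of \<Union>(range G) = {}"
      using Met_TC.metric_Baire_category_alt[of "range G"] closedG
      by (auto simp: mcomplete_iff_complete complete_UNIV)
    then show False using UG by simp
  qed
  then obtain n u1 where "u1 \<in> interior (G n)" by blast
  then obtain s where s: "s > 0" "ball u1 s \<subseteq> G n" by (meson mem_interior)
  have "f y \<le> ereal (real n)" if "y \<in> ball y0 (s / real (Suc n))" for y
  proof -
    define w where "w = real (Suc n) *\<^sub>R (y - y0)"
    have "norm (y - y0) * real (Suc n) < s"
      using that by (simp add: dist_norm norm_minus_commute pos_less_divide_eq)
    then have "norm w < s" by (simp add: w_def mult.commute del: of_nat_Suc)
    then have "u1 + w \<in> G n" "u1 - w \<in> G n" using s by (auto simp: dist_norm)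
    then have 1: "f (y0 + (1 / real (Suc n)) *\<^sub>R (u1 + w)) \<le> ereal (real n)"
      "f (y0 - (1 / real (Suc n)) *\<^sub>R (u1 - w)) \<le> ereal (real n)"
      by (auto simp: G_def)
    \<comment> \<open>The centre \<open>u1\<close> enters the two points with opposite signs, so it
      cancels in their midpoint, which is \<open>y\<close>.\<close>
    define q r where "q = (1 / real (Suc n)) *\<^sub>R u1" and "r = (1 / real (Suc n)) *\<^sub>R w"
    have "(1/2) *\<^sub>R (y0 + (1 / real (Suc n)) *\<^sub>R (u1 + w)) + (1 - 1/2) *\<^sub>R (y0 - (1 / real (Suc n)) *\<^sub>R (u1 - w))
      = (1/2) *\<^sub>R ((y0 + (q + r)) + (y0 - (q - r)))"
      by (simp add: q_def r_def scaleR_add_right scaleR_diff_right)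
    also have "(y0 + (q + r)) + (y0 - (q - r)) = 2 *\<^sub>R (y0 + r)"
      by (simp add: scaleR_2)
    also have "(1/2) *\<^sub>R (2 *\<^sub>R (y0 + r)) = y0 + r" by simp
    also have "\<dots> = y" by (simp add: w_def r_def del: of_nat_Suc)
    finally show ?thesis
      using convex_fun_le[OF conv 1, of "1/2"] by simp
  qed
  then show ?thesis using s by (intro exI[of _ "real n"] exI[of _ "s / real (Suc n)"]) auto
qed

text \<open>An upper bound near \<open>y0\<close> yields a lower bound by reflection, and bounded
  oscillation of a convex function yields a Lipschitz constant on the half ball. The form with an
  arbitrary real bound \<open>a\<close> avoids differences of extended reals.\<close>

lemma convex_fun_locally_Lipschitz:
  fixes f :: "'b::banach \<Rightarrow> ereal"
  assumes proper: "proper_fun f" and lsc: "lsc_fun f" and conv: "convex_fun f"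
    and int: "y0 \<in> interior (edom f)"
  shows "\<exists>r>0. \<exists>l\<ge>0. \<forall>y\<in>ball y0 r. \<forall>y'\<in>ball y0 r. \<forall>a. f y \<le> ereal a \<longrightarrow> f y' \<le> ereal (a + l * norm (y' - y))"
proof -
  obtain M s where M: "s > 0" "\<And>y. y \<in> ball y0 s \<Longrightarrow> f y \<le> ereal M"
    using convex_fun_bounded_above_nhds[OF lsc conv int] by blast
  have "f y0 \<le> ereal M" "f y0 \<noteq> -\<infinity>" using M proper unfolding proper_fun_def by auto
  then obtain b where b: "f y0 = ereal b" by (cases "f y0") auto
  have low: "2 * b - M \<le> a" if "y \<in> ball y0 s" "f y \<le> ereal a" for y a
  proof -
    \<comment> \<open>\<open>y0\<close> is the midpoint of \<open>y\<close> and its reflection, at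
      which \<open>M\<close> is an upper bound.\<close>
    have "2 *\<^sub>R y0 - y \<in> ball y0 s"
      using that by (simp add: dist_norm scaleR_2 norm_minus_commute)
    then have "f (2 *\<^sub>R y0 - y) \<le> ereal M" using M by blast
    from convex_fun_le[OF conv that(2) this, of "1/2"]
    have "f ((1/2) *\<^sub>R y + (1 - 1/2) *\<^sub>R (2 *\<^sub>R y0 - y)) \<le> ereal (1/2 * a + (1 - 1/2) * M)" by simp
    moreover have "(1/2) *\<^sub>R y + (1 - 1/2) *\<^sub>R (2 *\<^sub>R y0 - y) = y0" by (simp add: algebra_simps)
    ultimately show ?thesis using b by simp
  qed
  have M0: "M - (2 * b - M) \<ge> 0" using low[of y0 M] M by simp
  define l where "l = 2 * (M - (2 * b - M)) / s"
  have "f y' \<le> ereal (a + l * norm (y' - y))"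
    if y: "y \<in> ball y0 (s/2)" "y' \<in> ball y0 (s/2)" "f y \<le> ereal a" for y y' a
  proof (cases "y' = y")
    case True then show ?thesis using that by simp
  next
    case False
    define d where "d = norm (y' - y)"
    have d: "d > 0" using False by (simp add: d_def)
    \<comment> \<open>Prolong the segment from \<open>y\<close> through \<open>y'\<close> by length
      \<open>s / 2\<close>, which stays in the large ball; \<open>y'\<close> is then a convex
      combination of \<open>y2\<close> and \<open>y\<close> with weight \<open>c\<close> on
      \<open>y2\<close>, and \<open>c\<close> is at most \<open>2 * d / s\<close>.\<close>
    define y2 where "y2 = y' + (s / 2 / d) *\<^sub>R (y' - y)"
    have "norm (y2 - y') = s / 2" using d M by (simp add: y2_def flip: d_def)
    then have "dist y0 y2 < s" using y(2) norm_triangle_ineq[of "y2 - y'" "y' - y0"]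
      by (simp add: dist_norm norm_minus_commute)
    then have f2: "f y2 \<le> ereal M" using M by simp
    define c where "c = d / (d + s/2)"
    have c: "0 \<le> c" "c \<le> 1" "c \<le> 2 * d / s" using d M by (auto simp: c_def field_simps)
    have c1: "c * (s / 2 / d) = 1 - c" using d M by (simp add: c_def field_simps)
    have "c *\<^sub>R y2 + (1 - c) *\<^sub>R y = c *\<^sub>R y' + (c * (s / 2 / d)) *\<^sub>R (y' - y) + (1 - c) *\<^sub>R y"
      by (simp add: y2_def scaleR_add_right)
    also have "\<dots> = y'" unfolding c1 by (simp add: algebra_simps)
    finally have "f y' \<le> ereal (c * M + (1 - c) * a)"
      using convex_fun_le[OF conv f2 y(3) c(1,2)] by simp
    also have "c * M + (1 - c) * a \<le> a + l * norm (y' - y)"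
    proof -
      have "M - a \<le> M - (2 * b - M)" using low[of y a] y M by simp
      then have "c * (M - a) \<le> c * (M - (2 * b - M))" using c by (intro mult_left_mono) auto
      also have "\<dots> \<le> 2 * d / s * (M - (2 * b - M))" using c M0 by (intro mult_right_mono) auto
      also have "\<dots> = l * norm (y' - y)" by (simp add: l_def d_def)
      finally show ?thesis by (simp add: algebra_simps)
    qed
    finally show ?thesis by simp
  qed
  moreover have "l \<ge> 0" using M0 M by (simp add: l_def)
  ultimately show ?thesis using M by (intro exI[of _ "s/2"] conjI exI[of _ l]) auto
qed

text \<open>By convexity the difference quotients increase with \<open>t\<close>, so their right
  limit exists and is their infimum. This gives meaning to the \<open>Lim\<close> in
  \<open>dir_deriv\<close>.\<close>

lemma dir_deriv_tendsto:
  assumes conv: "convex_fun f" and y: "f y = 0"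
  shows "((\<lambda>t. f (y + t *\<^sub>R v) / ereal t) \<longlongrightarrow> dir_deriv f y v) (at_right 0)"
proof -
  define q where "q t = f (y + t *\<^sub>R v) / ereal t" for t
  have mono: "q s \<le> q t" if st: "0 < s" "s < t" for s t
  proof (cases "f (y + t *\<^sub>R v)")
    case (real a)
    have "f ((s/t) *\<^sub>R (y + t *\<^sub>R v) + (1 - s/t) *\<^sub>R y) \<le> ereal ((s/t) * a + (1 - s/t) * 0)"
      using st real y by (intro convex_fun_le[OF conv]) auto
    moreover have "(s/t) *\<^sub>R (y + t *\<^sub>R v) + (1 - s/t) *\<^sub>R y = y + s *\<^sub>R v"
      using st by (simp add: algebra_simps)
    ultimately have "f (y + s *\<^sub>R v) \<le> ereal ((s/t) * a)" by simp
    then show ?thesis using st real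
      by (cases "f (y + s *\<^sub>R v)") (auto simp: q_def field_simps)
  next
    case PInf
    then show ?thesis using st by (simp add: q_def)
  next
    case MInf
    \<comment> \<open>The value \<open>-\<infinity>\<close> at step \<open>t\<close> lies below the
      bound \<open>B * t / s\<close>, for which convexity returns exactly \<open>B\<close> at step
      \<open>s\<close>.\<close>
    have "f (y + s *\<^sub>R v) \<le> ereal B" for B
    proof -
      have "f ((s/t) *\<^sub>R (y + t *\<^sub>R v) + (1 - s/t) *\<^sub>R y) \<le> ereal ((s/t) * (B * t / s) + (1 - s/t) * 0)"
        using st MInf y by (intro convex_fun_le[OF conv]) auto
      moreover have "(s/t) *\<^sub>R (y + t *\<^sub>R v) + (1 - s/t) *\<^sub>R y = y + s *\<^sub>R v"
        using st by (simp add: algebra_simps)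
      ultimately show ?thesis using st by simp
    qed
    then have "f (y + s *\<^sub>R v) = -\<infinity>" by (simp add: ereal_bot)
    then show ?thesis using st by (simp add: q_def)
  qed
  have "(q \<longlongrightarrow> (INF t\<in>{0<..}. q t)) (at_right 0)"
  proof (rule order_tendstoI)
    fix a assume "a < (INF t\<in>{0<..}. q t)"
    then show "eventually (\<lambda>t. a < q t) (at_right 0)"
      by (auto simp: eventually_at_filter less_INF_D)
  next
    fix a assume "(INF t\<in>{0<..}. q t) < a"
    then obtain t where "t > 0" "q t < a" by (auto simp: INF_less_iff)
    then show "eventually (\<lambda>t. q t < a) (at_right 0)"
      unfolding eventually_at_right_field using mono by (intro exI[of _ t]) (auto intro: le_less_trans)
  qed
  moreover from this have "dir_deriv f y v = (INF t\<in>{0<..}. q t)"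
    unfolding dir_deriv_def using y by (intro tendsto_Lim) (simp_all add: q_def[abs_def])
  ultimately show ?thesis by (simp add: q_def[abs_def])
qed

lemma dir_deriv_le_1I:
  assumes conv: "convex_fun f" and y: "f y = 0"
    and ev: "eventually (\<lambda>t. f (y + t *\<^sub>R v) \<le> ereal t) (at_right 0)"
  shows "dir_deriv f y v \<le> 1"
proof (rule tendsto_upperbound[OF dir_deriv_tendsto[OF conv y]])
  show "eventually (\<lambda>t. f (y + t *\<^sub>R v) / ereal t \<le> 1) (at_right 0)"
    using ev eventually_at_right_less[of 0]
  proof eventually_elim
    case (elim t)
    then show ?case by (cases "f (y + t *\<^sub>R v)") (auto simp: one_ereal_def)
  qed
qed auto

text \<open>A limit of at most 1 controls the nearby quotients only up to a factor
  \<open>c > 1\<close>; the excess estimate takes \<open>c = 1 + \<eta>\<close> with \<eta>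
  small.\<close>

lemma dir_deriv_le_1D:
  assumes conv: "convex_fun f" and y: "f y = 0" and le: "dir_deriv f y v \<le> 1" and c: "c > 1"
  shows "eventually (\<lambda>t. f (y + t *\<^sub>R v) \<le> ereal (c * t)) (at_right 0)"
proof -
  have "dir_deriv f y v < ereal c"
    using le c by (auto simp: one_ereal_def intro: le_less_trans)
  then have "eventually (\<lambda>t. f (y + t *\<^sub>R v) / ereal t < ereal c) (at_right 0)"
    using dir_deriv_tendsto[OF conv y] order_tendstoD(2) by blast
  then show ?thesis using eventually_at_right_less[of 0]
  proof eventually_elim
    case (elim t)
    then show ?case by (cases "f (y + t *\<^sub>R v)") (auto simp: field_simps)
  qed
qed

section \<open>Bouligand tangent cones and Ekeland's principle\<close>

text \<open>One tolerance \<open>e\<close> bounds both the step and the error in the direction; the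
  values \<open>1 / Suc n\<close> of \<open>e\<close> give back the sequences.\<close>

lemma bouligand_cone_iff:
  "v \<in> bouligand_cone C c \<longleftrightarrow> (\<forall>e>0. \<exists>t w. 0 < t \<and> t < e \<and> dist w v < e \<and> c + t *\<^sub>R w \<in> C)"
proof
  assume "v \<in> bouligand_cone C c"
  then obtain vs ts where *: "vs \<longlonglongrightarrow> v" "ts \<longlonglongrightarrow> 0" "\<And>n. ts n > (0::real)" "\<And>n. c + ts n *\<^sub>R vs n \<in> C"
    unfolding bouligand_cone_def by blast
  show "\<forall>e>0. \<exists>t w. 0 < t \<and> t < e \<and> dist w v < e \<and> c + t *\<^sub>R w \<in> C"
  proof (intro allI impI)
    fix e :: real assume "e > 0"
    then have "eventually (\<lambda>n. dist (vs n) v < e \<and> ts n < e) sequentially"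
      using tendstoD[OF *(1)] order_tendstoD(2)[OF *(2)] by (auto intro: eventually_conj)
    then obtain n where "dist (vs n) v < e" "ts n < e"
      using eventually_happens trivial_limit_sequentially by blast
    then show "\<exists>t w. 0 < t \<and> t < e \<and> dist w v < e \<and> c + t *\<^sub>R w \<in> C" using * by blast
  qed
next
  assume "\<forall>e>0. \<exists>t w. 0 < t \<and> t < e \<and> dist w v < e \<and> c + t *\<^sub>R w \<in> C"
  then have "\<exists>t w. 0 < t \<and> t < inverse (real (Suc n)) \<and> dist w v < inverse (real (Suc n)) \<and> c + t *\<^sub>R w \<in> C" for n
    by (simp del: of_nat_Suc)
  then obtain ts where "\<And>n. \<exists>w. 0 < ts n \<and> ts n < inverse (real (Suc n)) \<and>
      dist w v < inverse (real (Suc n)) \<and> c + ts n *\<^sub>R w \<in> C"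
    by metis
  then obtain vs where p: "\<And>n. 0 < ts n \<and> ts n < inverse (real (Suc n)) \<and>
      dist (vs n) v < inverse (real (Suc n)) \<and> c + ts n *\<^sub>R vs n \<in> C"
    by metis
  have "(\<lambda>n. dist (vs n) v) \<longlonglongrightarrow> 0"
  proof (rule Lim_null_comparison[OF always_eventually LIMSEQ_inverse_real_of_nat], rule allI)
    fix n
    have "dist (vs n) v < inverse (real (Suc n))" using p[of n] by blast
    then show "norm (dist (vs n) v) \<le> inverse (real (Suc n))" by (simp only: real_norm_def abs_of_nonneg zero_le_dist less_imp_le)
  qed
  then have "vs \<longlonglongrightarrow> v" by (subst tendsto_dist_iff)
  moreover have "ts \<longlonglongrightarrow> 0"
  proof (rule Lim_null_comparison[OF always_eventually LIMSEQ_inverse_real_of_nat], rule allI)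
    fix n
    have "0 < ts n" "ts n < inverse (real (Suc n))" using p[of n] by blast+
    then show "norm (ts n) \<le> inverse (real (Suc n))" by (simp only: real_norm_def abs_of_pos less_imp_le)
  qed
  ultimately show "v \<in> bouligand_cone C c"
    unfolding bouligand_cone_def using p by blast
qed

lemma bouligand_cone_scaleR:
  assumes "v \<in> bouligand_cone C c" "l > 0"
  shows "l *\<^sub>R v \<in> bouligand_cone C c"
proof -
  obtain vs ts where *: "vs \<longlonglongrightarrow> v" "ts \<longlonglongrightarrow> 0" "\<And>n. ts n > (0::real)" "\<And>n. c + ts n *\<^sub>R vs n \<in> C"
    using assms(1) unfolding bouligand_cone_def by blast
  have "(\<lambda>n. l *\<^sub>R vs n) \<longlonglongrightarrow> l *\<^sub>R v" "(\<lambda>n. ts n / l) \<longlonglongrightarrow> 0"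
    using * assms(2) by (auto intro!: tendsto_eq_intros)
  then show ?thesis
    unfolding bouligand_cone_def using * assms
    by (auto intro!: exI[of _ "\<lambda>n. l *\<^sub>R vs n"] exI[of _ "\<lambda>n. ts n / l"])
qed

text \<open>The segment from \<open>c\<close> to \<open>z\<close> stays in \<open>C\<close>, so the
  constant sequence \<open>z - c\<close> witnesses tangency; the cone property does the
  scaling.\<close>

lemma convex_bouligand_cone:
  assumes "convex C" "c \<in> C" "z \<in> C" "t > 0"
  shows "(1 / t) *\<^sub>R (z - c) \<in> bouligand_cone C c"
proof -
  have "z - c \<in> bouligand_cone C c"
    unfolding bouligand_cone_def
  proof (clarify, intro exI conjI allI)
    show "(\<lambda>n. z - c) \<longlonglongrightarrow> z - c" by simp
    show "(\<lambda>n. inverse (real (Suc n))) \<longlonglongrightarrow> 0" by (rule LIMSEQ_inverse_real_of_nat)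
    fix n
    have "(1 - inverse (real (Suc n))) *\<^sub>R c + inverse (real (Suc n)) *\<^sub>R z \<in> C"
      using assms by (intro convexD_alt) (auto simp: field_simps)
    then show "c + inverse (real (Suc n)) *\<^sub>R (z - c) \<in> C" by (simp only: algebra_simps scaleR_one)
  qed simp
  then show ?thesis using assms by (intro bouligand_cone_scaleR) auto
qed

lemma zero_in_bouligand_cone:
  assumes "c \<in> C" shows "0 \<in> bouligand_cone C c"
  unfolding bouligand_cone_iff
proof (intro allI impI)
  fix e :: real assume "e > 0"
  then show "\<exists>t w. 0 < t \<and> t < e \<and> dist w 0 < e \<and> c + t *\<^sub>R w \<in> C"
    using assms by (intro exI[of _ "e/2"] exI[of _ 0]) auto
qed

text \<open>Short steps in any fixed direction stay in a ball inside \<open>S\<close>. This serves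
  to force an Ekeland point onto the boundary.\<close>

lemma bouligand_cone_interior:
  assumes "z \<in> interior S"
  shows "w \<in> bouligand_cone S z"
  unfolding bouligand_cone_iff
proof (intro allI impI)
  fix e :: real assume e: "e > 0"
  obtain \<rho> where \<rho>: "\<rho> > 0" "ball z \<rho> \<subseteq> S" using assms by (meson mem_interior)
  have pos: "norm w + 1 > 0" by (intro add_nonneg_pos) auto
  define t where "t = min (e / 2) (\<rho> / (norm w + 1))"
  have t: "t > 0" "t < e" using e \<rho> pos by (auto simp: t_def)
  have "t * (norm w + 1) \<le> \<rho>" using pos by (simp add: t_def flip: pos_le_divide_eq)
  then have "t * norm w < \<rho>" using t by (simp add: distrib_left)
  then have "z + t *\<^sub>R w \<in> S" using \<rho>(2) t by (auto simp: dist_norm)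
  then show "\<exists>t w'. 0 < t \<and> t < e \<and> dist w' w < e \<and> z + t *\<^sub>R w' \<in> S"
    using t e by (intro exI[of _ t] exI[of _ w]) auto
qed

text \<open>Membership \<open>u \<in> R z\<close> is a transitive relation. Each iterate is a
  near-minimiser of \<open>\<phi>\<close> over the set \<open>R\<close> of its predecessor; the
  iterates converge, and their limit cannot be improved by more than the penalty.\<close>

lemma Ekeland_variational_principle:
  fixes \<phi> :: "'a::complete_space \<Rightarrow> real"
  assumes S: "closed S" "z0 \<in> S" and cont: "continuous_on S \<phi>" and low: "\<And>u. u \<in> S \<Longrightarrow> m \<le> \<phi> u"
    and \<eta>: "\<eta> > 0"
  shows "\<exists>z\<in>S. \<phi> z + \<eta> * dist z z0 \<le> \<phi> z0 \<and> (\<forall>u\<in>S. \<phi> z \<le> \<phi> u + \<eta> * dist u z)"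
proof -
  define R where "R z = {u\<in>S. \<phi> u + \<eta> * dist u z \<le> \<phi> z}" for z
  have step: "\<exists>w. w \<in> R z \<and> (\<forall>u\<in>R z. \<phi> w \<le> \<phi> u + (1/2)^n)" if "z \<in> S" for z n
  proof -
    have ne: "R z \<noteq> {}" using that by (auto simp: R_def)
    have bb: "bdd_below (\<phi> ` R z)" using low by (auto simp: R_def intro!: bdd_belowI[of _ m])
    have "Inf (\<phi> ` R z) < Inf (\<phi> ` R z) + (1/2)^n" by simp
    from cInf_lessD[OF _ this] obtain w where "w \<in> R z" "\<phi> w < Inf (\<phi> ` R z) + (1/2)^n"
      using ne by auto
    moreover have "Inf (\<phi> ` R z) \<le> \<phi> u" if "u \<in> R z" for u
      using that bb by (intro cInf_lower) auto
    ultimately show ?thesis by (intro exI[of _ w]) (auto intro: order_trans[OF less_imp_le])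
  qed
  have "\<exists>z. \<forall>n. z n \<in> S \<and> (n = 0 \<longrightarrow> z n = z0) \<and> z (Suc n) \<in> R (z n) \<and> (\<forall>u\<in>R (z n). \<phi> (z (Suc n)) \<le> \<phi> u + (1/2)^n)"
  proof -
    have "\<exists>z. \<forall>n. (z n \<in> S \<and> (n = 0 \<longrightarrow> z n = z0)) \<and> (z (Suc n) \<in> R (z n) \<and> (\<forall>u\<in>R (z n). \<phi> (z (Suc n)) \<le> \<phi> u + (1/2)^n))"
    proof (rule dependent_nat_choice)
      show "\<exists>x. x \<in> S \<and> (0 = 0 \<longrightarrow> x = z0)" using S by auto
      fix x and n :: nat assume "x \<in> S \<and> (n = 0 \<longrightarrow> x = z0)"
      then show "\<exists>y. (y \<in> S \<and> (Suc n = 0 \<longrightarrow> y = z0)) \<and> y \<in> R x \<and> (\<forall>u\<in>R x. \<phi> y \<le> \<phi> u + (1 / 2) ^ n)"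
        using step[of x n] by (auto simp: R_def)
    qed
    then show ?thesis by blast
  qed
  then obtain z where z: "\<And>n. z n \<in> S" "z 0 = z0" "\<And>n. z (Suc n) \<in> R (z n)"
      "\<And>n u. u \<in> R (z n) \<Longrightarrow> \<phi> (z (Suc n)) \<le> \<phi> u + (1/2)^n"
    by metis
  have trans: "u \<in> R w" if "u \<in> R v" "v \<in> R w" for u v w
  proof -
    have "\<eta> * dist u w \<le> \<eta> * dist u v + \<eta> * dist v w"
      using \<eta> dist_triangle[of u w v] by (metis distrib_left less_imp_le mult_left_mono)
    then show ?thesis using that by (auto simp: R_def)
  qed
  have R: "z (n + k) \<in> R (z n)" for n k
  proof (induction k)
    case 0 show ?case using z by (simp add: R_def)
  next
    case (Suc k) show ?case using trans[OF z(3) Suc] by simp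
  qed
  have dec: "decseq (\<lambda>n. \<phi> (z n))"
  proof (rule decseq_SucI)
    fix n
    have "\<eta> * dist (z (Suc n)) (z n) \<ge> 0" using \<eta> by simp
    then show "\<phi> (z (Suc n)) \<le> \<phi> (z n)" using z(3)[of n] by (simp add: R_def)
  qed
  obtain L where L: "(\<lambda>n. \<phi> (z n)) \<longlonglongrightarrow> L" "\<And>n. L \<le> \<phi> (z n)"
    using decseq_convergent[OF dec, of m] low z(1) by blast
  have "Cauchy z"
  proof (rule metric_CauchyI)
    fix e :: real assume e: "e > 0"
    have "eventually (\<lambda>n. \<phi> (z n) < L + \<eta> * e / 2) sequentially"
      using L(1) e \<eta> by (intro order_tendstoD(2)[OF L(1)]) auto
    then obtain N where N: "\<phi> (z N) < L + \<eta> * e / 2"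
      using eventually_happens trivial_limit_sequentially by blast
    \<comment> \<open>Distances between iterates are paid for by the drop of \<open>\<phi>\<close>,
      which is small once \<open>\<phi> (z N)\<close> is close to the limit
      \<open>L\<close>.\<close>
    have "dist (z n) (z N) < e / 2" if "n \<ge> N" for n
    proof -
      have "\<phi> (z n) + \<eta> * dist (z n) (z N) \<le> \<phi> (z N)"
        using R[of N "n - N"] that by (simp add: R_def)
      then have "\<eta> * dist (z n) (z N) < \<eta> * (e / 2)" using N L(2)[of n] by simp
      then show ?thesis using \<eta> by simp
    qed
    then show "\<exists>M. \<forall>i\<ge>M. \<forall>j\<ge>M. dist (z i) (z j) < e"
      by (meson dist_triangle_half_l dist_commute)
  qed
  then obtain w where w: "z \<longlonglongrightarrow> w" using Cauchy_convergent convergent_def by blast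
  have wS: "w \<in> S" using S(1) z(1) w closed_sequentially by blast
  have \<phi>w: "(\<lambda>n. \<phi> (z n)) \<longlonglongrightarrow> \<phi> w"
    using cont w z(1) wS by (auto simp: continuous_on_sequentially o_def)
  have wR: "w \<in> R (z n)" for n
  proof -
    have "(\<lambda>k. \<phi> (z (k + n)) + \<eta> * dist (z (k + n)) (z n)) \<longlonglongrightarrow> \<phi> w + \<eta> * dist w (z n)"
      by (intro tendsto_intros LIMSEQ_ignore_initial_segment[OF \<phi>w] LIMSEQ_ignore_initial_segment[OF w])
    then have "\<phi> w + \<eta> * dist w (z n) \<le> \<phi> (z n)"
      by (rule LIMSEQ_le_const2) (use R[of n] in \<open>auto simp: R_def add.commute\<close>)
    then show ?thesis using wS by (simp add: R_def)
  qed
  have "\<phi> w \<le> \<phi> u + \<eta> * dist u w" if u: "u \<in> S" for u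
  proof (rule ccontr)
    assume *: "\<not> ?thesis"
    \<comment> \<open>A violating \<open>u\<close> would lie in every \<open>R (z n)\<close>, so
      near-minimality, with errors tending to 0, would give
      \<open>\<phi> w \<le> \<phi> u\<close>.\<close>
    then have "u \<in> R w" using u by (simp add: R_def)
    then have "u \<in> R (z n)" for n using trans wR by blast
    then have "\<phi> (z (Suc n)) \<le> \<phi> u + (1/2)^n" for n using z(4) by blast
    moreover have "(\<lambda>n. \<phi> u + (1/2)^n) \<longlonglongrightarrow> \<phi> u + 0"
      by (intro tendsto_intros) auto
    ultimately have "\<phi> w \<le> \<phi> u + 0"
      using LIMSEQ_Suc[OF \<phi>w] by (intro LIMSEQ_le) auto
    moreover have "\<eta> * dist u w \<ge> 0" using \<eta> by simp
    ultimately show False using * by linarith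
  qed
  then show ?thesis using wR[of 0] wS z(2) by (auto simp: R_def)
qed

text \<open>A nearest point of \<open>S\<close> may not exist in a Banach space; an Ekeland point of
  the distance to \<open>x\<close> replaces it. A tangent vector coming too close to
  \<open>x - z\<close> would shorten the distance to \<open>x\<close> faster than the penalty
  allows.\<close>

lemma almost_projection_on_tangent_cone:
  fixes S :: "'a::banach set"
  assumes S: "closed S" "xbar \<in> S" "x \<notin> S" and \<epsilon>: "0 < \<epsilon>" "\<epsilon> < 1"
  shows "\<exists>z\<in>frontier S. norm (x - z) \<le> norm (x - xbar) \<and>
    (\<forall>w\<in>bouligand_cone S z. (1 - \<epsilon>) * norm (x - z) \<le> norm (x - z - w))"
proof -
  \<comment> \<open>The penalty along a step costs about
    \<open>\<eta> * 2 * D = \<epsilon> * D / 2\<close> per unit, half of the assumed gain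
    \<open>\<epsilon> * D\<close>; the errors of size \<open>e\<close> use up at most
    \<open>5/16 * \<epsilon> * D\<close> of the rest.\<close>
  define \<eta> where "\<eta> = \<epsilon> / 4"
  have \<eta>: "\<eta> > 0" using \<epsilon> by (simp add: \<eta>_def)
  have "\<exists>z\<in>S. norm (x - z) + \<eta> * dist z xbar \<le> norm (x - xbar) \<and>
      (\<forall>u\<in>S. norm (x - z) \<le> norm (x - u) + \<eta> * dist u z)"
    by (rule Ekeland_variational_principle[where m = 0]) (use S \<eta> in \<open>auto intro!: continuous_intros\<close>)
  then obtain z where z: "z \<in> S" "norm (x - z) + \<eta> * dist z xbar \<le> norm (x - xbar)"
    "\<And>u. u \<in> S \<Longrightarrow> norm (x - z) \<le> norm (x - u) + \<eta> * dist u z" by blast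
  define D where "D = norm (x - z)"
  have D: "D > 0" using z S by (auto simp: D_def)
  have *: "(1 - \<epsilon>) * D \<le> norm (x - z - w)" if w: "w \<in> bouligand_cone S z" for w
  proof (rule ccontr)
    assume neg: "\<not> ?thesis"
    define e where "e = min 1 (\<epsilon> * D / 4)"
    have e: "e > 0" "e \<le> 1" "e \<le> \<epsilon> * D / 4" using \<epsilon> D by (auto simp: e_def)
    obtain t w' where t: "0 < t" "t < e" "dist w' w < e" "z + t *\<^sub>R w' \<in> S"
      using w e(1) unfolding bouligand_cone_iff by blast
    have ww: "norm (w - w') < e" using t by (simp add: dist_norm norm_minus_commute)
    have w1: "norm (x - z - w') \<le> (1 - \<epsilon>) * D + e"
      using norm_triangle_ineq[of "x - z - w" "w - w'"] ww neg by simp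
    have "\<epsilon> * D > 0" using \<epsilon> D by simp
    then have "norm (x - z - w') \<le> D + e" using w1 by (simp add: left_diff_distrib)
    then have w2: "norm w' \<le> 2 * D + e"
      using norm_triangle_ineq4[of "x - z" "x - z - w'"] by (simp add: D_def)
    have "x - (z + t *\<^sub>R w') = (1 - t) *\<^sub>R (x - z) + t *\<^sub>R (x - z - w')"
      by (simp add: algebra_simps)
    then have "norm (x - (z + t *\<^sub>R w')) \<le> (1 - t) * D + t * norm (x - z - w')"
      using norm_triangle_ineq[of "(1 - t) *\<^sub>R (x - z)" "t *\<^sub>R (x - z - w')"] t e(2) by (simp add: D_def)
    moreover have "D \<le> norm (x - (z + t *\<^sub>R w')) + \<eta> * (t * norm w')"
      using z(3)[OF t(4)] t(1) by (simp add: D_def dist_norm)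
    ultimately have "t * D \<le> t * (norm (x - z - w') + \<eta> * norm w')"
      by (simp add: algebra_simps)
    then have "D \<le> norm (x - z - w') + \<eta> * norm w'" using t(1) by simp
    also have "\<dots> \<le> (1 - \<epsilon>) * D + e + \<eta> * (2 * D + e)"
      using w1 w2 \<eta> by (intro add_mono mult_left_mono) auto
    also have "\<dots> = D - \<epsilon> * D / 2 + (1 + \<epsilon> / 4) * e" by (simp add: \<eta>_def algebra_simps)
    also have "(1 + \<epsilon> / 4) * e \<le> (5/4) * (\<epsilon> * D / 4)"
      using e \<epsilon> by (intro mult_mono) auto
    finally show False using \<open>\<epsilon> * D > 0\<close> by (simp add: mult.commute)
  qed
  have "z \<notin> interior S"
  proof
    assume "z \<in> interior S"
    \<comment> \<open>At an interior point \<open>w = x - z\<close> is tangent, so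
      \<open>(1 - \<epsilon>) * D\<close> would be at most 0.\<close>
    from *[OF bouligand_cone_interior[OF this, of "x - z"]] show False
      using D \<epsilon> by (simp add: mult_le_0_iff)
  qed
  then have "z \<in> frontier S" using z(1) closure_subset by (auto simp: frontier_def)
  moreover have "norm (x - z) \<le> norm (x - xbar)"
    using z(2) mult_nonneg_nonneg[OF less_imp_le[OF \<eta>] zero_le_dist[of z xbar]] by linarith
  ultimately show ?thesis using * by (auto simp: D_def)
qed

section \<open>Metric regularity\<close>

text \<open>The iteration of the open mapping theorem: each correction halves the residual, and
  completeness of the domain sums the corrections. The factor 2 is the geometric series.\<close>

lemma blinfun_surj_from_approx:
  fixes A :: "'a::banach \<Rightarrow>\<^sub>L 'b::real_normed_vector"
  assumes K: "K \<ge> 0" and approx: "\<And>v. \<exists>u. norm u \<le> K * norm v \<and> norm (v - A u) \<le> norm v / 2"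
  shows "\<exists>u. A u = v \<and> norm u \<le> 2 * K * norm v"
proof -
  obtain p where p: "\<And>v. norm (p v) \<le> K * norm v" "\<And>v. norm (v - A (p v)) \<le> norm v / 2"
    using approx by metis
  define r where "r n = ((\<lambda>v. v - A (p v)) ^^ n) v" for n
  have r0: "r 0 = v" and rSuc: "r (Suc n) = r n - A (p (r n))" for n by (auto simp: r_def)
  have nr: "norm (r n) \<le> norm v * (1/2)^n" for n
  proof (induction n)
    case 0 then show ?case by (simp add: r0)
  next
    case (Suc n)
    then show ?case using p(2)[of "r n"] by (simp add: rSuc)
  qed
  have np: "norm (p (r n)) \<le> K * norm v * (1/2)^n" for n
    using order_trans[OF p(1) mult_left_mono[OF nr K]] by (simp add: mult.assoc)
  have g: "(\<lambda>n. K * norm v * (1/2::real)^n) sums (K * norm v * 2)"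
    using geometric_sums[of "1/2::real"] by (intro sums_mult) simp
  have sn: "summable (\<lambda>n. norm (p (r n)))"
    using np sums_summable[OF g] by (intro summable_comparison_test[OF _ sums_summable[OF g]]) auto
  have s: "summable (\<lambda>n. p (r n))" by (rule summable_norm_cancel[OF sn])
  have r_lim: "r \<longlonglongrightarrow> 0"
  proof (rule Lim_null_comparison)
    show "eventually (\<lambda>n. norm (r n) \<le> norm v * (1/2)^n) sequentially" using nr by simp
    show "(\<lambda>n. norm v * (1/2)^n) \<longlonglongrightarrow> 0" by (intro tendsto_mult_right_zero LIMSEQ_power_zero) auto
  qed
  have "(\<lambda>n. A (p (r n))) sums A (\<Sum>n. p (r n))"
    by (rule bounded_linear.sums[OF blinfun.bounded_linear_right summable_sums[OF s]])
  moreover have "(\<lambda>n. r n - r (Suc n)) sums (r 0 - 0)"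
    by (rule telescope_sums'[OF r_lim])
  then have "(\<lambda>n. A (p (r n))) sums v" by (simp add: rSuc r0)
  ultimately have "A (\<Sum>n. p (r n)) = v" using sums_unique2 by blast
  moreover have "norm (\<Sum>n. p (r n)) \<le> (\<Sum>n. norm (p (r n)))" by (rule summable_norm[OF sn])
  moreover have "(\<Sum>n. norm (p (r n))) \<le> K * norm v * 2"
    using suminf_le[OF np sn sums_summable[OF g]] sums_unique[OF g] by simp
  ultimately show ?thesis by (intro exI[of _ "\<Sum>n. p (r n)"]) auto
qed

lemma edist_set_le_obtain:
  assumes "edist_set x D \<le> ereal c" "c < c'"
  obtains z where "z \<in> D" "dist x z < c'"
proof -
  have D: "D \<noteq> {}" "infdist x D \<le> c" using assms by (auto simp: edist_set_def split: if_splits)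
  then have "Inf (dist x ` D) < c'" using assms by (simp add: infdist_def)
  then show thesis using cInf_lessD[of "dist x ` D" c'] D that by auto
qed

text \<open>Regularity solves \<open>g z = g x + t v\<close> with \<open>z\<close> near
  \<open>x\<close>; by differentiability \<open>(z - x) / t\<close> is then a preimage of
  \<open>v\<close> up to an error of \<open>norm v / 2\<close>, and iterating the approximation
  makes it exact.\<close>

lemma metric_regularity_derivative_open:
  fixes g :: "'a::banach \<Rightarrow> 'b::real_normed_vector" and A :: "'a \<Rightarrow>\<^sub>L 'b"
  assumes \<kappa>: "\<kappa> > 0" and V: "open V" "g x \<in> V"
    and reg: "\<And>y. y \<in> V \<Longrightarrow> edist_set x (g -` {y}) \<le> ereal (\<kappa> * norm (g x - y))"
    and der: "(g has_derivative A) (at x)"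
  shows "\<exists>K\<ge>0. \<forall>v. \<exists>u. A u = v \<and> norm u \<le> K * norm v"
proof -
  \<comment> \<open>Strictly larger than \<kappa>, because the distance to a fibre need not be
    attained.\<close>
  define K where "K = \<kappa> + 1"
  have K: "K > 0" using \<kappa> by (simp add: K_def)
  have "\<exists>u. norm u \<le> K * norm v \<and> norm (v - A u) \<le> norm v / 2" for v
  proof (cases "v = 0")
    case True then show ?thesis by (intro exI[of _ 0]) auto
  next
    case False
    have "1 / (2 * K) > 0" using K by simp
    then obtain d where d: "d > 0" "\<And>z. norm (z - x) < d \<Longrightarrow> norm (g z - g x - A (z - x)) \<le> 1 / (2 * K) * norm (z - x)"
      using der unfolding has_derivative_at_alt by meson
    obtain \<rho> where \<rho>: "\<rho> > 0" "ball (g x) \<rho> \<subseteq> V" using V openE by blast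
    \<comment> \<open>Small enough for the target \<open>g x + t v\<close> to lie in
      \<open>V\<close> and for the solution \<open>z\<close> to lie in the radius \<open>d\<close>
      of the linear approximation.\<close>
    define t where "t = min (d / (K * norm v)) (\<rho> / (2 * norm v))"
    have t: "t > 0" "t * norm v < \<rho>" "K * (t * norm v) \<le> d"
    proof -
      have nv: "norm v > 0" using False by simp
      show "t > 0" using nv K d \<rho> by (simp add: t_def)
      have "t * norm v \<le> \<rho> / (2 * norm v) * norm v" using nv by (intro mult_right_mono) (auto simp: t_def)
      then show "t * norm v < \<rho>" using nv \<rho> by simp
      have "t * (K * norm v) \<le> d / (K * norm v) * (K * norm v)"
        using nv K by (intro mult_right_mono) (auto simp: t_def)
      then show "K * (t * norm v) \<le> d" using nv K by (simp add: ac_simps)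
    qed
    have "g x + t *\<^sub>R v \<in> V" using \<rho>(2) t by (auto simp: dist_norm)
    from reg[OF this] have "edist_set x (g -` {g x + t *\<^sub>R v}) \<le> ereal (\<kappa> * (t * norm v))"
      using t by simp
    moreover have "\<kappa> * (t * norm v) < K * (t * norm v)" using t False by (simp add: K_def)
    ultimately obtain z where "z \<in> g -` {g x + t *\<^sub>R v}" and dz: "dist x z < K * (t * norm v)"
      by (rule edist_set_le_obtain)
    then have z: "g z = g x + t *\<^sub>R v" by simp
    have nz: "norm (z - x) < K * (t * norm v)" using dz by (simp add: dist_norm norm_minus_commute)
    have "norm (g z - g x - A (z - x)) \<le> 1 / (2 * K) * norm (z - x)" using d nz t by auto
    also have "\<dots> \<le> 1 / (2 * K) * (K * (t * norm v))" using nz K by (intro mult_left_mono) auto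
    also have "\<dots> = t * (norm v / 2)" using K by simp
    finally have "norm (t *\<^sub>R v - A (z - x)) \<le> t * (norm v / 2)" using z by simp
    moreover have "t *\<^sub>R v - A (z - x) = t *\<^sub>R (v - A ((1 / t) *\<^sub>R (z - x)))"
      using t by (simp only: blinfun.scaleR_right scaleR_diff_right[of t]) simp
    ultimately have "norm (v - A ((1 / t) *\<^sub>R (z - x))) \<le> norm v / 2" using t by simp
    moreover have "norm ((1 / t) *\<^sub>R (z - x)) \<le> K * norm v"
      using nz t by (simp only: norm_scaleR) (simp add: field_simps)
    ultimately show ?thesis by blast
  qed
  then show ?thesis using blinfun_surj_from_approx[of K A] K
    by (intro exI[of _ "2 * K"]) auto
qed

text \<open>\<open>g (z + t h)\<close> misses the point \<open>g z + t w\<close> of \<open>C\<close>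
  only by a small multiple of \<open>t\<close>. Regularity moves \<open>z + t h\<close> by less than
  \<open>t * e\<close> to a point \<open>u\<close> with \<open>g u = g z + t w\<close>.\<close>

lemma bouligand_cone_vimage:
  fixes g :: "'a::real_normed_vector \<Rightarrow> 'b::real_normed_vector"
  assumes \<kappa>: "\<kappa> > 0" and U: "open U" "z \<in> U" and V: "open V" "g z \<in> V"
    and reg: "\<And>x y. x \<in> U \<Longrightarrow> y \<in> V \<Longrightarrow> edist_set x (g -` {y}) \<le> ereal (\<kappa> * norm (g x - y))"
    and der: "(g has_derivative A) (at z)"
    and h: "A h \<in> bouligand_cone C (g z)"
  shows "h \<in> bouligand_cone (g -` C) z"
  unfolding bouligand_cone_iff
proof (intro allI impI)
  fix e :: real assume e: "e > 0"
  interpret A: bounded_linear A using der has_derivative_bounded_linear by blast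
  \<comment> \<open>Linearisation contributes \<open>e1 * norm h\<close> and the direction error
    \<open>e1\<close>, per unit of \<open>t\<close>; multiplied by \<kappa>, their sum is
    \<open>e / 2\<close>, which leaves room for a strict inequality.\<close>
  define e1 where "e1 = e / (2 * (\<kappa> * (norm h + 1)))"
  have e1: "e1 > 0" using e \<kappa> by (auto simp: e1_def intro!: divide_pos_pos mult_pos_pos add_nonneg_pos)
  have e1': "\<kappa> * (e1 * (norm h + 1)) = e / 2"
  proof -
    have "norm h + 1 \<noteq> 0" using norm_ge_zero[of h] by linarith
    then show ?thesis using \<kappa> by (simp add: e1_def)
  qed
  obtain d where d: "d > 0" "\<And>y. norm (y - z) < d \<Longrightarrow> norm (g y - g z - A (y - z)) \<le> e1 * norm (y - z)"
    using der e1 unfolding has_derivative_at_alt by meson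
  obtain \<rho> where \<rho>: "\<rho> > 0" "ball (g z) \<rho> \<subseteq> V" using V openE by blast
  obtain \<sigma> where \<sigma>: "\<sigma> > 0" "ball z \<sigma> \<subseteq> U" using U openE by blast
  define e2 where "e2 = Min {e, e1, 1, d / (norm h + 1), \<sigma> / (norm h + 1), \<rho> / (norm (A h) + 1)}"
  have pos: "norm h + 1 > 0" "norm (A h) + 1 > 0" by (auto intro: add_nonneg_pos)
  have e2: "e2 > 0" using e e1 d \<rho> \<sigma> pos by (auto simp: e2_def)
  have e2le: "e2 \<le> e" "e2 \<le> e1" "e2 \<le> 1" "e2 \<le> d / (norm h + 1)" "e2 \<le> \<sigma> / (norm h + 1)"
    "e2 \<le> \<rho> / (norm (A h) + 1)" by (auto simp: e2_def)
  then have e2le': "e2 * (norm h + 1) \<le> d" "e2 * (norm h + 1) \<le> \<sigma>" "e2 * (norm (A h) + 1) \<le> \<rho>"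
    using pos by (auto simp: pos_le_divide_eq)
  obtain t w where tw: "0 < t" "t < e2" "dist w (A h) < e2" "g z + t *\<^sub>R w \<in> C"
    using h e2 unfolding bouligand_cone_iff by blast
  have th: "t * norm h < e2 * (norm h + 1)"
    using tw by (intro mult_strict_mono') auto
  have "norm w \<le> norm (A h) + 1" using tw(3) e2le(3) norm_triangle_ineq2[of w "A h"] by (simp add: dist_norm)
  then have "t * norm w \<le> t * (norm (A h) + 1)"
    using tw by (intro mult_left_mono) auto
  also have "\<dots> < e2 * (norm (A h) + 1)"
    using tw pos by (intro mult_strict_right_mono) auto
  finally have "t * norm w < e2 * (norm (A h) + 1)" .
  then have "t * norm w < \<rho>" using e2le'(3) by linarith
  then have inV: "g z + t *\<^sub>R w \<in> V" using \<rho> tw by (auto simp: dist_norm)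
  have inU: "z + t *\<^sub>R h \<in> U" using \<sigma> th e2le'(2) tw by (auto simp: dist_norm)
  have "norm (g (z + t *\<^sub>R h) - g z - A (t *\<^sub>R h)) \<le> e1 * norm (t *\<^sub>R h)"
    using d(2)[of "z + t *\<^sub>R h"] th e2le'(1) tw by simp
  then have "norm (g (z + t *\<^sub>R h) - g z - t *\<^sub>R A h) \<le> t * (e1 * norm h)"
    using tw by (simp add: A.scaleR ac_simps)
  moreover have "norm (t *\<^sub>R A h - t *\<^sub>R w) \<le> t * e1"
    using tw e2le(2) by (simp add: dist_norm norm_minus_commute flip: scaleR_diff_right)
  ultimately have "norm (g (z + t *\<^sub>R h) - (g z + t *\<^sub>R w)) \<le> t * (e1 * (norm h + 1))"
    using norm_triangle_ineq[of "g (z + t *\<^sub>R h) - g z - t *\<^sub>R A h" "t *\<^sub>R A h - t *\<^sub>R w"]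
    by (simp add: algebra_simps)
  then have "\<kappa> * norm (g (z + t *\<^sub>R h) - (g z + t *\<^sub>R w)) \<le> \<kappa> * (t * (e1 * (norm h + 1)))"
    using \<kappa> by (intro mult_left_mono) auto
  also have "\<dots> = t * (\<kappa> * (e1 * (norm h + 1)))" by (simp only: ac_simps)
  also have "\<dots> = t * (e / 2)" by (simp only: e1')
  finally have "edist_set (z + t *\<^sub>R h) (g -` {g z + t *\<^sub>R w}) \<le> ereal (t * (e / 2))"
    using reg[OF inU inV] by (meson ereal_less_eq(3) order_trans)
  moreover have "t * (e / 2) < t * e" using tw e by simp
  ultimately obtain u where "u \<in> g -` {g z + t *\<^sub>R w}" and u2: "dist (z + t *\<^sub>R h) u < t * e"
    by (rule edist_set_le_obtain)
  then have u: "g u = g z + t *\<^sub>R w" by simp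
  have "(1 / t) *\<^sub>R (u - z) - h = (1 / t) *\<^sub>R (u - (z + t *\<^sub>R h))"
    using tw by (simp add: algebra_simps)
  then have "dist ((1 / t) *\<^sub>R (u - z)) h = norm (u - (z + t *\<^sub>R h)) / t"
    using tw unfolding dist_norm by simp
  then have "dist ((1 / t) *\<^sub>R (u - z)) h < e"
    using u2 tw by (simp add: dist_norm norm_minus_commute pos_divide_less_eq mult.commute)
  moreover have "z + t *\<^sub>R (1 / t) *\<^sub>R (u - z) \<in> g -` C" using tw u by simp
  ultimately show "\<exists>t w. 0 < t \<and> t < e \<and> dist w h < e \<and> z + t *\<^sub>R w \<in> g -` C"
    using tw e2le(1) by (intro exI[of _ t] exI[of _ "(1 / t) *\<^sub>R (u - z)"]) auto
qed

text \<open>Mean value inequality on a ball where \<open>g'\<close> oscillates by at most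
  \<open>e\<close>. The base point \<open>z\<close> has to vary, since the boundary point found by
  Ekeland's principle depends on \<open>x\<close>.\<close>

lemma C1_strict_derivative:
  fixes g :: "'a::real_normed_vector \<Rightarrow> 'b::real_normed_vector" and g' :: "'a \<Rightarrow> ('a \<Rightarrow>\<^sub>L 'b)"
  assumes der: "\<And>x. (g has_derivative blinfun_apply (g' x)) (at x)"
    and cont: "continuous_on UNIV g'" and e: "e > 0"
  shows "\<exists>\<delta>>0. \<forall>x\<in>ball xbar \<delta>. \<forall>z\<in>ball xbar \<delta>. norm (g x - g z - g' z (x - z)) \<le> e * norm (x - z)"
proof -
  obtain \<delta> where \<delta>: "\<delta> > 0" "\<And>x. dist x xbar < \<delta> \<Longrightarrow> dist (g' x) (g' xbar) < e / 2"
    using cont e unfolding continuous_on_iff by (meson UNIV_I half_gt_zero)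
  have "norm (g x - g z - g' z (x - z)) \<le> norm (x - z) * e" if xz: "x \<in> ball xbar \<delta>" "z \<in> ball xbar \<delta>" for x z
  proof (rule differentiable_bound_linearization[where S = "ball xbar \<delta>"])
    show "z + t *\<^sub>R (x - z) \<in> ball xbar \<delta>" if "t \<in> {0..1}" for t
      using convexD_alt[OF convex_ball xz(2,1), of t] that by (simp add: algebra_simps)
    show "(g has_derivative g' w) (at w within ball xbar \<delta>)" for w
      using der has_derivative_at_withinI by blast
    show "onorm (blinfun_apply (g' w) - blinfun_apply (g' z)) \<le> e" if "w \<in> ball xbar \<delta>" for w
    proof -
      have "norm (g' w - g' z) \<le> e"
        using \<delta>(2)[of w] \<delta>(2)[of z] that xz dist_triangle_half_l[of "g' w" "g' xbar" e "g' z"]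
        by (simp add: dist_commute dist_norm less_imp_le)
      then show ?thesis by (simp add: norm_blinfun.rep_eq minus_blinfun.rep_eq fun_diff_def)
    qed
    show "z \<in> ball xbar \<delta>" by fact
  qed
  then show ?thesis using \<delta> by (intro exI[of _ \<delta>]) (auto simp: mult.commute)
qed

section \<open>Error bounds\<close>

lemma eventually_at_right_ball:
  fixes y :: "'b::real_normed_vector"
  assumes "y \<in> ball y0 r"
  shows "eventually (\<lambda>t. y + t *\<^sub>R v \<in> ball y0 r) (at_right (0::real))"
proof -
  have "((\<lambda>t. y + t *\<^sub>R v) \<longlongrightarrow> y + 0 *\<^sub>R v) (at_right (0::real))"
    by (intro tendsto_intros)
  then show ?thesis
    using assms topological_tendstoD[of _ y _ "ball y0 r"] by simp
qed

text \<open>Every error made in passing from \<open>h\<close> to a vector of \<open>D\<close> is a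
  multiple of \<eta>: the growth of \<open>f\<close> along \<open>x + t h\<close>, the distance to a
  solution \<open>z\<close>, and the linearisation defect \<open>q\<close> that surjectivity of
  \<open>A\<close> repairs.\<close>

lemma excess_le_if_error_bound:
  fixes g :: "'a::real_normed_vector \<Rightarrow> 'b::real_normed_vector" and A :: "'a \<Rightarrow>\<^sub>L 'b"
  assumes conv: "convex_fun f" and fx: "f (g x) = 0" and der: "(g has_derivative A) (at x)"
    and lip: "\<And>y y' a. y \<in> ball y0 r \<Longrightarrow> y' \<in> ball y0 r \<Longrightarrow> f y \<le> ereal a \<Longrightarrow>
      f y' \<le> ereal (a + l * norm (y' - y))"
    and l: "l \<ge> 0" and gx: "g x \<in> ball y0 r"
    and K: "K \<ge> 0" "\<And>v. \<exists>u. A u = v \<and> norm u \<le> K * norm v"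
    and \<delta>: "\<delta> > 0" and \<tau>: "\<tau> > 0"
    and eb: "\<And>x'. x' \<in> ball x \<delta> \<Longrightarrow>
      edist_set x' {z. f (g z) \<le> 0} \<le> ereal \<tau> * max (f (g x')) 0"
  shows "excess {h. dir_deriv f (g x) (A h) \<le> 1} {h. A h \<in> bouligand_cone {y. f y \<le> 0} (g x)} \<le> ereal \<tau>"
proof -
  define D where "D = {h. A h \<in> bouligand_cone {y. f y \<le> 0} (g x)}"
  have D0: "0 \<in> D" using fx zero_in_bouligand_cone[of "g x" "{y. f y \<le> 0}"] by (simp add: D_def blinfun.zero_right)
  have "infdist h D \<le> \<tau>" if h: "dir_deriv f (g x) (A h) \<le> 1" for h
  proof (rule field_le_epsilon)
    fix e :: real assume e: "e > 0"
    \<comment> \<open>\<open>t * \<eta> * B\<close> collects the excess over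
      \<open>\<tau> * t\<close> in the distance to the solution set; its summand 1 makes the bound
      strict, so that a solution \<open>z\<close> can be picked. \<open>R\<close> bounds both
      \<open>norm h\<close> and \<open>norm w\<close>.\<close>
    define B where "B = \<tau> + \<tau> * (l * norm h) + 1"
    define R where "R = norm h + \<tau> + B"
    have B: "B > 0" using \<tau> l by (auto simp: B_def intro!: add_nonneg_pos add_nonneg_nonneg)
    have R: "R > 0" using \<tau> B by (auto simp: R_def intro!: add_nonneg_pos)
    have BK: "B + K * R > 0" using B K R by (intro add_pos_nonneg) auto
    define \<eta> where "\<eta> = min 1 (e / (B + K * R))"
    have \<eta>: "\<eta> > 0" "\<eta> \<le> 1" "\<eta> * (B + K * R) \<le> e"
      using e BK by (auto simp: \<eta>_def simp flip: pos_le_divide_eq)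
    obtain d where d: "d > 0" "\<And>y. norm (y - x) < d \<Longrightarrow> norm (g y - g x - A (y - x)) \<le> \<eta> * norm (y - x)"
      using der \<eta>(1) unfolding has_derivative_at_alt by meson
    have "((\<lambda>t. x + t *\<^sub>R h) \<longlongrightarrow> x + 0 *\<^sub>R h) (at_right (0::real))"
      by (intro tendsto_intros)
    then have "((\<lambda>t. g (x + t *\<^sub>R h)) \<longlongrightarrow> g x) (at_right (0::real))"
      using isCont_tendsto_compose[OF has_derivative_continuous[OF der]] by force
    then have ev1: "eventually (\<lambda>t. g (x + t *\<^sub>R h) \<in> ball y0 r) (at_right (0::real))"
      using topological_tendstoD[of _ "g x" _ "ball y0 r"] gx by simp
    have ev2: "eventually (\<lambda>t. f (g x + t *\<^sub>R A h) \<le> ereal ((1 + \<eta>) * t)) (at_right 0)"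
      using \<eta> by (intro dir_deriv_le_1D[OF conv fx h]) auto
    have ev3: "eventually (\<lambda>t::real. t < min (d / R) (\<delta> / R)) (at_right 0)"
      using d \<delta> R by (intro order_tendstoD(2)[OF tendsto_ident_at]) auto
    have "eventually (\<lambda>t. 0 < t \<and> g (x + t *\<^sub>R h) \<in> ball y0 r \<and> f (g x + t *\<^sub>R A h) \<le> ereal ((1 + \<eta>) * t)
      \<and> t < min (d / R) (\<delta> / R) \<and> g x + t *\<^sub>R A h \<in> ball y0 r) (at_right 0)"
      using ev1 ev2 ev3 eventually_at_right_ball[OF gx, of "A h"] eventually_at_right_less[of 0]
      by eventually_elim auto
    then obtain t where t: "0 < t" "g (x + t *\<^sub>R h) \<in> ball y0 r" "f (g x + t *\<^sub>R A h) \<le> ereal ((1 + \<eta>) * t)"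
      "t < d / R" "t < \<delta> / R" "g x + t *\<^sub>R A h \<in> ball y0 r"
      using eventually_happens[of _ "at_right (0::real)"] by (auto simp: trivial_limit_at_right_real)
    have tR: "t * R < d" "t * R < \<delta>" using t R by (auto simp: pos_less_divide_eq)
    have "norm h \<le> R" using \<tau> B by (simp add: R_def)
    then have "t * norm h \<le> t * R" using t by simp
    then have th: "t * norm h < d" "t * norm h < \<delta>" using tR by auto
    have "norm (g (x + t *\<^sub>R h) - (g x + t *\<^sub>R A h)) \<le> \<eta> * (t * norm h)"
      using d(2)[of "x + t *\<^sub>R h"] th t(1) by (simp add: blinfun.scaleR_right diff_diff_add)
    then have "l * norm (g (x + t *\<^sub>R h) - (g x + t *\<^sub>R A h)) \<le> l * (\<eta> * (t * norm h))"
      using l by (intro mult_left_mono)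
    moreover have "f (g (x + t *\<^sub>R h)) \<le> ereal ((1 + \<eta>) * t + l * norm (g (x + t *\<^sub>R h) - (g x + t *\<^sub>R A h)))"
      using lip t by blast
    ultimately have "f (g (x + t *\<^sub>R h)) \<le> ereal ((1 + \<eta>) * t + l * (\<eta> * (t * norm h)))"
      by (meson add_left_mono ereal_less_eq(3) order_trans)
    moreover have "0 \<le> (1 + \<eta>) * t + l * (\<eta> * (t * norm h))" using \<eta> t l by (intro add_nonneg_nonneg) auto
    ultimately have "max (f (g (x + t *\<^sub>R h))) 0 \<le> ereal ((1 + \<eta>) * t + l * (\<eta> * (t * norm h)))"
      by simp
    then have "ereal \<tau> * max (f (g (x + t *\<^sub>R h))) 0 \<le> ereal \<tau> * ereal ((1 + \<eta>) * t + l * (\<eta> * (t * norm h)))"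
      using \<tau> by (intro ereal_mult_left_mono) auto
    moreover have "x + t *\<^sub>R h \<in> ball x \<delta>" using th t(1) by (simp add: dist_norm)
    ultimately have ed: "edist_set (x + t *\<^sub>R h) {z. f (g z) \<le> 0} \<le> ereal (\<tau> * ((1 + \<eta>) * t + l * (\<eta> * (t * norm h))))"
      using eb[of "x + t *\<^sub>R h"] by auto
    have "\<tau> * ((1 + \<eta>) * t + l * (\<eta> * (t * norm h))) < t * (\<tau> + \<eta> * B)"
    proof -
      have "t * (\<tau> + \<eta> * B) = \<tau> * ((1 + \<eta>) * t + l * (\<eta> * (t * norm h))) + t * \<eta>"
        by (simp add: B_def algebra_simps)
      then show ?thesis using t \<eta> by simp
    qed
    with ed obtain z where z: "z \<in> {z. f (g z) \<le> 0}" "dist (x + t *\<^sub>R h) z < t * (\<tau> + \<eta> * B)"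
      by (rule edist_set_le_obtain)
    define w where "w = (1 / t) *\<^sub>R (z - x)"
    have zw: "z - x = t *\<^sub>R w" using t by (simp add: w_def)
    have "t *\<^sub>R (h - w) = (x + t *\<^sub>R h) - z" using zw by (simp add: scaleR_diff_right algebra_simps)
    then have "t * norm (h - w) = dist (x + t *\<^sub>R h) z" using t(1) by (metis abs_of_pos dist_norm norm_scaleR)
    then have "t * norm (h - w) < t * (\<tau> + \<eta> * B)" using z by simp
    then have hw: "norm (h - w) < \<tau> + \<eta> * B" using t by simp
    have "\<eta> * B \<le> 1 * B" using \<eta> B by (intro mult_right_mono) auto
    then have wR: "norm w \<le> R" using hw norm_triangle_ineq4[of h "h - w"] by (simp add: R_def)
    \<comment> \<open>The quotient of \<open>g\<close> is tangent by convexity of the sublevel set,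
      but it is not \<open>A w\<close>; adding \<open>u\<close> with \<open>A u = q\<close> to
      \<open>w\<close> closes the gap.\<close>
    define q where "q = (1 / t) *\<^sub>R (g z - g x) - A w"
    have "norm (z - x) = t * norm w" using zw t by simp
    moreover have "t * norm w \<le> t * R" using wR t by simp
    ultimately have "norm (g z - g x - A (z - x)) \<le> \<eta> * (t * norm w)"
      using d(2)[of z] tR by simp
    moreover have "g z - g x - A (z - x) = t *\<^sub>R q"
      using t by (simp add: q_def zw blinfun.scaleR_right scaleR_diff_right)
    ultimately have "t * norm q \<le> t * (\<eta> * norm w)" using t by (simp add: ac_simps)
    then have "norm q \<le> \<eta> * norm w" using t by simp
    also have "\<dots> \<le> \<eta> * R" using wR \<eta> by simp
    finally have q: "norm q \<le> \<eta> * R" .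
    obtain u where u: "A u = q" "norm u \<le> K * norm q" using K by blast
    have "norm u \<le> K * (\<eta> * R)" using u q K by (meson mult_left_mono order_trans)
    have "(1 / t) *\<^sub>R (g z - g x) \<in> bouligand_cone {y. f y \<le> 0} (g x)"
      using convex_sublevel[OF conv, of 0] z fx t
      by (intro convex_bouligand_cone) (auto simp: zero_ereal_def)
    moreover have "A (w + u) = (1 / t) *\<^sub>R (g z - g x)" by (simp add: blinfun.add_right u q_def)
    ultimately have "w + u \<in> D" by (simp add: D_def)
    moreover have "dist h (w + u) \<le> \<tau> + e"
    proof -
      have "dist h (w + u) \<le> norm (h - w) + norm u"
        using norm_triangle_ineq4[of "h - w" u] by (simp add: dist_norm diff_diff_add)
      also have "\<dots> \<le> \<tau> + \<eta> * (B + K * R)"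
        using hw \<open>norm u \<le> K * (\<eta> * R)\<close> by (simp add: algebra_simps)
      finally show ?thesis using \<eta> by simp
    qed
    ultimately show "infdist h D \<le> \<tau> + e" by (rule infdist_le2)
  qed
  then show ?thesis using D0 \<tau> by (auto simp: excess_def simp flip: D_def intro!: SUP_least)
qed

text \<open>The vector \<open>x - z\<close>, scaled to have directional derivative at most 1, is
  within \<tau> of the cone by the excess bound, while \<open>proj\<close> bounds the same distance
  from below because the cone is invariant under scaling.\<close>

lemma error_bound_if_excess_le:
  fixes g :: "'a::real_normed_vector \<Rightarrow> 'b::real_normed_vector" and A :: "'a \<Rightarrow>\<^sub>L 'b"
  assumes conv: "convex_fun f" and fz: "f (g z) = 0"
    and lip: "\<And>y y' a. y \<in> ball y0 r \<Longrightarrow> y' \<in> ball y0 r \<Longrightarrow> f y \<le> ereal a \<Longrightarrow>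
      f y' \<le> ereal (a + l * norm (y' - y))"
    and l: "l \<ge> 0" and gz: "g z \<in> ball y0 r"
    and fx: "f (g x) \<le> ereal a" "a > 0" and \<epsilon>: "\<epsilon> > 0"
    and lin: "norm (g x - g z - A (x - z)) \<le> \<epsilon> * norm (x - z)"
    and ex: "excess {h. dir_deriv f (g z) (A h) \<le> 1} {h. A h \<in> bouligand_cone {y. f y \<le> 0} (g z)} \<le> ereal \<tau>"
    and proj: "\<And>w. A w \<in> bouligand_cone {y. f y \<le> 0} (g z) \<Longrightarrow> (1 - \<epsilon>) * norm (x - z) \<le> norm (x - z - w)"
  shows "(1 - \<epsilon>) * norm (x - z) \<le> \<tau> * (a + l * (\<epsilon> * norm (x - z)))"
proof -
  define D where "D = {h. A h \<in> bouligand_cone {y. f y \<le> 0} (g z)}"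
  have D0: "D \<noteq> {}" using fz zero_in_bouligand_cone[of "g z" "{y. f y \<le> 0}"]
    by (auto simp: D_def blinfun.zero_right intro!: exI[of _ 0])
  \<comment> \<open>An upper bound for the growth along \<open>A (x - z)\<close>: convexity gives
    slope \<open>a\<close> along \<open>g x - g z\<close>, and the Lipschitz estimate pays for
    replacing this by its linearisation.\<close>
  define b where "b = a + l * (\<epsilon> * norm (x - z))"
  have b: "b > 0" using fx(2) l \<epsilon> by (auto simp: b_def intro!: add_pos_nonneg)
  define h where "h = (1 / b) *\<^sub>R (x - z)"
  have "dir_deriv f (g z) (A h) \<le> 1"
  proof (rule dir_deriv_le_1I[OF conv fz])
    have ev: "eventually (\<lambda>t::real. t < b) (at_right 0)"
      using b by (intro order_tendstoD(2)[OF tendsto_ident_at]) auto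
    show "eventually (\<lambda>t. f (g z + t *\<^sub>R A h) \<le> ereal t) (at_right 0)"
      using ev eventually_at_right_ball[OF gz, of "A h"] eventually_at_right_less[of 0]
        eventually_at_right_ball[OF gz, of "(1 / b) *\<^sub>R (g x - g z)"]
    proof eventually_elim
      case (elim t)
      define s where "s = t / b"
      have s: "0 < s" "s < 1" "s * b = t" using elim b by (auto simp: s_def)
      have 1: "g z + t *\<^sub>R (1 / b) *\<^sub>R (g x - g z) = g z + s *\<^sub>R (g x - g z)" by (simp add: s_def)
      have 2: "g z + t *\<^sub>R A h = g z + s *\<^sub>R A (x - z)" by (simp add: s_def h_def blinfun.scaleR_right)
      have "f (s *\<^sub>R g x + (1 - s) *\<^sub>R g z) \<le> ereal (s * a + (1 - s) * 0)"
        using s fx fz by (intro convex_fun_le[OF conv]) auto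
      then have "f (g z + s *\<^sub>R (g x - g z)) \<le> ereal (s * a)" by (simp add: algebra_simps)
      then have "f (g z + s *\<^sub>R A (x - z)) \<le>
          ereal (s * a + l * norm (g z + s *\<^sub>R A (x - z) - (g z + s *\<^sub>R (g x - g z))))"
        using elim unfolding 1 2 by (intro lip)
      also have "s * a + l * norm (g z + s *\<^sub>R A (x - z) - (g z + s *\<^sub>R (g x - g z))) \<le> t"
      proof -
        have "norm (g z + s *\<^sub>R A (x - z) - (g z + s *\<^sub>R (g x - g z))) = s * norm (g x - g z - A (x - z))"
          using s(1) by (simp add: norm_minus_commute flip: scaleR_diff_right)
        also have "\<dots> \<le> s * (\<epsilon> * norm (x - z))" using lin s by simp
        finally have "s * a + l * norm (g z + s *\<^sub>R A (x - z) - (g z + s *\<^sub>R (g x - g z))) \<le> s * a + l * (s * (\<epsilon> * norm (x - z)))"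
          using l by (intro add_left_mono mult_left_mono)
        also have "\<dots> = s * b" by (simp add: b_def algebra_simps)
        finally show ?thesis using s by simp
      qed
      finally show ?case unfolding 2 by simp
    qed
  qed
  then have "ereal (infdist h D) \<le> ereal \<tau>"
    using ex D0 by (auto simp: excess_def SUP_le_iff simp flip: D_def split: if_splits)
  moreover have "(1 - \<epsilon>) * norm (x - z) / b \<le> infdist h D"
    unfolding infdist_notempty[OF D0]
  proof (rule cINF_greatest[OF D0])
    fix w assume "w \<in> D"
    then have "A (b *\<^sub>R w) \<in> bouligand_cone {y. f y \<le> 0} (g z)"
      using b by (simp add: D_def blinfun.scaleR_right bouligand_cone_scaleR)
    from proj[OF this] have "(1 - \<epsilon>) * norm (x - z) \<le> norm (x - z - b *\<^sub>R w)" .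
    also have "x - z - b *\<^sub>R w = b *\<^sub>R (h - w)" using b by (simp add: h_def scaleR_diff_right)
    also have "norm (b *\<^sub>R (h - w)) = norm (h - w) * b" using b by (simp only: norm_scaleR) simp
    finally show "(1 - \<epsilon>) * norm (x - z) / b \<le> dist h w"
      using b by (simp add: dist_norm pos_divide_le_eq)
  qed
  ultimately have "(1 - \<epsilon>) * norm (x - z) / b \<le> \<tau>" by simp
  then show ?thesis using b by (simp only: pos_divide_le_eq b_def)
qed

section \<open>Order properties of the excess and of the restricted limit superior\<close>

lemma excess_nonneg: "0 \<le> excess C D"
proof -
  have "0 \<le> (SUP x\<in>C. ereal (infdist x D))" if "c \<in> C" for c
    using that by (intro SUP_upper2[OF that]) (simp add: infdist_nonneg)
  then show ?thesis by (auto simp: excess_def)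
qed

lemma limsup_within_nonneg:
  assumes "\<And>x. 0 \<le> F x"
  shows "0 \<le> limsup_within D xbar F"
  unfolding limsup_within_def
proof (rule INF_greatest)
  fix \<delta> :: real
  have "0 \<le> (SUP x\<in>D \<inter> ball xbar \<delta>. F x)" if "x \<in> D \<inter> ball xbar \<delta>" for x
    using that assms by (rule SUP_upper2)
  then show "0 \<le> (if D \<inter> ball xbar \<delta> = {} then 0 else (SUP x\<in>D \<inter> ball xbar \<delta>. F x))"
    by (metis all_not_in_conv order_refl)
qed

lemma limsup_within_leI:
  assumes "\<delta> > 0" "\<And>x. x \<in> D \<inter> ball xbar \<delta> \<Longrightarrow> F x \<le> c" "0 \<le> c"
  shows "limsup_within D xbar F \<le> c"
  unfolding limsup_within_def
proof (rule INF_lower2)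
  show "\<delta> \<in> {0<..}" using assms(1) by simp
  have "(SUP x\<in>D \<inter> ball xbar \<delta>. F x) \<le> c" by (rule SUP_least) (rule assms(2))
  then show "(if D \<inter> ball xbar \<delta> = {} then 0 else (SUP x\<in>D \<inter> ball xbar \<delta>. F x)) \<le> c"
    using assms(3) by simp
qed

lemma limsup_within_lessE:
  assumes "limsup_within D xbar F < c"
  obtains \<delta> c' where "\<delta> > 0" "c' < c" "\<And>x. x \<in> D \<inter> ball xbar \<delta> \<Longrightarrow> F x \<le> c'"
proof -
  obtain \<delta> where \<delta>: "\<delta> > 0" "(if D \<inter> ball xbar \<delta> = {} then 0 else (SUP x\<in>D \<inter> ball xbar \<delta>. F x)) < c"
    using assms unfolding limsup_within_def INF_less_iff by blast
  show thesis
  proof (rule that[OF \<delta>])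
    fix x assume "x \<in> D \<inter> ball xbar \<delta>"
    then show "F x \<le> (if D \<inter> ball xbar \<delta> = {} then 0 else (SUP x\<in>D \<inter> ball xbar \<delta>. F x))"
      by (auto intro: SUP_upper)
  qed
qed

theorem theorem4p4:
  fixes g :: "'a::banach \<Rightarrow> 'b::banach"
    and g' :: "'a \<Rightarrow> ('a \<Rightarrow>\<^sub>L 'b)"
    and f :: "'b \<Rightarrow> ereal"
    and xbar :: 'a
  assumes deriv: "\<And>x. (g has_derivative blinfun_apply (g' x)) (at x)"
    and deriv_cont: "continuous_on UNIV g'"
    and f_proper: "proper_fun f" and f_lsc: "lsc_fun f" and f_convex: "convex_fun f"
    and bd: "frontier {y. f y \<le> 0} \<subseteq> {y. f y = 0}"
    and xbar_in: "xbar \<in> {x. f (g x) \<le> 0}"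
    and int_dom: "g xbar \<in> interior (edom f)"
    and reg: "metrically_regular_around g xbar"
  shows "(has_local_error_bound (\<lambda>x. f (g x)) xbar \<longleftrightarrow>
            limsup_within (frontier {x. f (g x) \<le> 0}) xbar
              (\<lambda>x. excess {h. dir_deriv f (g x) (g' x h) \<le> 1}
                           {h. g' x h \<in> bouligand_cone {y. f y \<le> 0} (g x)}) < \<infinity>)
       \<and> error_bound_modulus (\<lambda>x. f (g x)) xbar =
            limsup_within (frontier {x. f (g x) \<le> 0}) xbar
              (\<lambda>x. excess {h. dir_deriv f (g x) (g' x h) \<le> 1}
                           {h. g' x h \<in> bouligand_cone {y. f y \<le> 0} (g x)})"
proof -
  define S where "S = {x. f (g x) \<le> 0}"
  define F where "F x = excess {h. dir_deriv f (g x) (g' x h) \<le> 1}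
      {h. g' x h \<in> bouligand_cone {y. f y \<le> 0} (g x)}" for x
  have S_vimage: "S = g -` {y. f y \<le> 0}" by (auto simp: S_def)
  have contg: "continuous_on UNIV g"
    using deriv by (meson continuous_at_imp_continuous_on has_derivative_continuous)
  have closedS: "closed S"
    unfolding S_vimage using f_lsc contg by (intro closed_vimage) (auto simp: lsc_fun_def)
  have bdS: "f (g x) = 0" if "x \<in> frontier S" for x
  proof -
    have "x \<in> S" using that closedS by (simp add: frontier_closed subset_iff frontier_def)
    \<comment> \<open>By continuity an interior image would make \<open>x\<close> interior to
      \<open>S\<close>; hence \<open>g x\<close> is a boundary point of the sublevel set, where
      \<open>bd\<close> applies.\<close>
    have "g x \<notin> interior {y. f y \<le> 0}"
    proof
      assume "g x \<in> interior {y. f y \<le> 0}"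
      moreover have "open (g -` interior {y. f y \<le> 0})"
        using contg by (intro open_vimage) auto
      moreover have "g -` interior {y. f y \<le> 0} \<subseteq> S"
        using interior_subset by (auto simp: S_vimage)
      ultimately have "x \<in> interior S" using interior_maximal by blast
      then show False using that by (simp add: frontier_def)
    qed
    moreover have "g x \<in> closure {y. f y \<le> 0}"
      using \<open>x \<in> S\<close> by (intro subsetD[OF closure_subset]) (simp add: S_def)
    ultimately show ?thesis using bd by (auto simp: frontier_def)
  qed
  obtain r l where r: "r > 0" "l \<ge> 0" and lip: "\<And>y y' a. y \<in> ball (g xbar) r \<Longrightarrow> y' \<in> ball (g xbar) r \<Longrightarrow>
      f y \<le> ereal a \<Longrightarrow> f y' \<le> ereal (a + l * norm (y' - y))"
    using convex_fun_locally_Lipschitz[OF f_proper f_lsc f_convex int_dom] by blast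
  obtain \<kappa> U V where \<kappa>: "\<kappa> > 0" and U: "open U" "xbar \<in> U" and V: "open V" "g xbar \<in> V"
    and regUV: "\<And>x y. x \<in> U \<Longrightarrow> y \<in> V \<Longrightarrow> edist_set x (g -` {y}) \<le> ereal (\<kappa> * norm (g x - y))"
    using reg unfolding metrically_regular_around_def by blast
  \<comment> \<open>On one ball around \<open>xbar\<close> both metric regularity and the Lipschitz
    estimate for \<open>f\<close> are available.\<close>
  have "open (U \<inter> g -` (V \<inter> ball (g xbar) r))"
    using U V contg by (intro open_Int open_vimage) auto
  moreover have "xbar \<in> U \<inter> g -` (V \<inter> ball (g xbar) r)" using U V r by auto
  ultimately obtain \<rho> where \<rho>: "\<rho> > 0" "ball xbar \<rho> \<subseteq> U \<inter> g -` (V \<inter> ball (g xbar) r)"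
    using openE by blast
  have upper: "limsup_within (frontier S) xbar F \<le> ereal \<tau>"
    if eb: "error_bound_with (\<lambda>x. f (g x)) xbar \<tau>" for \<tau>
  proof -
    obtain \<delta> where \<tau>: "\<tau> > 0" and \<delta>: "\<delta> > 0" "\<And>x. x \<in> ball xbar \<delta> \<Longrightarrow>
        edist_set x {z. f (g z) \<le> 0} \<le> ereal \<tau> * max (f (g x)) 0"
      using eb unfolding error_bound_with_def by blast
    show ?thesis
    proof (rule limsup_within_leI[where \<delta> = "min \<delta> \<rho>"])
      fix x assume x: "x \<in> frontier S \<inter> ball xbar (min \<delta> \<rho>)"
      then have xr: "x \<in> U" "g x \<in> V" "g x \<in> ball (g xbar) r" using \<rho> by auto
      obtain K where K: "K \<ge> 0" "\<And>v. \<exists>u. g' x u = v \<and> norm u \<le> K * norm v"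
        using metric_regularity_derivative_open[OF \<kappa> V(1) xr(2) regUV[OF xr(1)] deriv] by blast
      have "x \<in> ball xbar \<delta>" using x by auto
      \<comment> \<open>The error bound at \<open>xbar\<close> holds with the same \<tau> around
        every nearby boundary point.\<close>
      then obtain \<delta>' where \<delta>': "\<delta>' > 0" "ball x \<delta>' \<subseteq> ball xbar \<delta>" using openE open_ball by blast
      show "F x \<le> ereal \<tau>"
        unfolding F_def
        by (rule excess_le_if_error_bound[where g = g and x = x and f = f, OF f_convex _ deriv lip r(2) xr(3) K \<delta>'(1) \<tau>])
          (use x bdS \<delta> \<delta>' in auto)
    qed (use \<delta> \<rho> \<tau> in auto)
  qed
  have lower: "error_bound_with (\<lambda>x. f (g x)) xbar \<tau>" if lim: "limsup_within (frontier S) xbar F < ereal \<tau>" for \<tau>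
  proof -
    have "0 \<le> limsup_within (frontier S) xbar F"
      by (intro limsup_within_nonneg) (simp add: F_def excess_nonneg)
    then have \<tau>: "\<tau> > 0" using lim by (metis ereal_less(2) le_less_trans)
    obtain \<delta>1 c where \<delta>1: "\<delta>1 > 0" "c < ereal \<tau>" "\<And>x. x \<in> frontier S \<inter> ball xbar \<delta>1 \<Longrightarrow> F x \<le> c"
      using limsup_within_lessE[OF lim] by blast
    obtain c' where c': "c < ereal c'" "c' < \<tau>" using ereal_dense2[OF \<delta>1(2)] by auto
    \<comment> \<open>Strictly between 0 and \<tau>, yet still an upper bound for the excess near
      \<open>xbar\<close>; the gap to \<tau> absorbs the errors of order \<epsilon>.\<close>
    define \<tau>0 where "\<tau>0 = max c' (\<tau> / 2)"
    have \<tau>0: "0 < \<tau>0" "\<tau>0 < \<tau>" using \<tau> c' by (auto simp: \<tau>0_def)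
    have "c \<le> ereal \<tau>0" using c' by (metis \<tau>0_def ereal_less_eq(3) less_imp_le max.cobounded1 order_trans)
    then have F\<tau>0: "F x \<le> ereal \<tau>0" if "x \<in> frontier S" "x \<in> ball xbar \<delta>1" for x
      using \<delta>1(3)[of x] that by auto
    \<comment> \<open>chosen so that \<open>1 - \<epsilon> - \<tau>0 * l * \<epsilon> = \<tau>0 / \<tau>\<close>\<close>
    define \<epsilon> where "\<epsilon> = (1 - \<tau>0 / \<tau>) / (1 + \<tau>0 * l)"
    have l1: "1 + \<tau>0 * l \<ge> 1" using \<tau>0 r by simp
    have q: "0 < \<tau>0 / \<tau>" "\<tau>0 / \<tau> < 1" using \<tau>0 by auto
    have \<epsilon>eq: "\<epsilon> * (1 + \<tau>0 * l) = 1 - \<tau>0 / \<tau>" using l1 by (simp add: \<epsilon>_def)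
    have \<epsilon>0: "\<epsilon> > 0" using l1 q by (auto simp: \<epsilon>_def intro!: divide_pos_pos)
    have "\<epsilon> * 1 \<le> \<epsilon> * (1 + \<tau>0 * l)" using \<epsilon>0 l1 by (intro mult_left_mono) auto
    then have \<epsilon>1: "\<epsilon> < 1" using \<epsilon>eq q by linarith
    obtain \<delta>2 where \<delta>2: "\<delta>2 > 0" "\<And>x z. x \<in> ball xbar \<delta>2 \<Longrightarrow> z \<in> ball xbar \<delta>2 \<Longrightarrow>
        norm (g x - g z - g' z (x - z)) \<le> \<epsilon> * norm (x - z)"
      using C1_strict_derivative[OF deriv deriv_cont \<epsilon>0] by blast
    \<comment> \<open>Halved because \<open>z\<close> may be up to twice as far from
      \<open>xbar\<close> as \<open>x\<close>.\<close>
    define \<delta> where "\<delta> = min \<rho> (min \<delta>1 \<delta>2) / 2"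
    have "edist_set x {z. f (g z) \<le> 0} \<le> ereal \<tau> * max (f (g x)) 0" if x: "x \<in> ball xbar \<delta>" for x
    proof (cases "x \<in> S \<or> f (g x) = \<infinity>")
      case True
      then show ?thesis
      proof
        assume "x \<in> S"
        then have "edist_set x {z. f (g z) \<le> 0} = 0" by (auto simp: edist_set_def S_def)
        then show ?thesis using \<tau> by simp
      next
        assume "f (g x) = \<infinity>"
        then show ?thesis using \<tau> by (simp add: max_def)
      qed
    next
      case False
      then obtain a where a: "f (g x) = ereal a" "a > 0" by (cases "f (g x)") (auto simp: S_def)
      have "x \<notin> S" "xbar \<in> S" using False xbar_in by (auto simp: S_def)
      then obtain z where z: "z \<in> frontier S" "norm (x - z) \<le> norm (x - xbar)"
        "\<And>w. w \<in> bouligand_cone S z \<Longrightarrow> (1 - \<epsilon>) * norm (x - z) \<le> norm (x - z - w)"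
        using almost_projection_on_tangent_cone[OF closedS _ _ \<epsilon>0 \<epsilon>1] by blast
      have x2: "norm (x - xbar) < \<delta>" using x by (simp add: dist_norm norm_minus_commute)
      then have "norm (z - xbar) < 2 * \<delta>"
        using z(2) norm_triangle_ineq4[of "x - xbar" "x - z"] by simp
      then have zb: "z \<in> ball xbar \<rho>" "z \<in> ball xbar \<delta>1" "z \<in> ball xbar \<delta>2"
        by (auto simp: \<delta>_def dist_norm norm_minus_commute)
      have xb: "x \<in> ball xbar \<delta>2" using x \<rho> \<delta>1 \<delta>2 by (auto simp: \<delta>_def)
      have zr: "z \<in> U" "g z \<in> V" "g z \<in> ball (g xbar) r" using zb \<rho> by auto
      \<comment> \<open>Ekeland's principle speaks of the tangent cone of \<open>S\<close>;
        regularity transfers its estimate to the preimage of the tangent cone of the sublevel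
        set.\<close>
      have proj: "(1 - \<epsilon>) * norm (x - z) \<le> norm (x - z - w)"
        if "g' z w \<in> bouligand_cone {y. f y \<le> 0} (g z)" for w
        using z(3) bouligand_cone_vimage[OF \<kappa> U(1) zr(1) V(1) zr(2) regUV deriv that] by (simp add: S_vimage)
      have "(1 - \<epsilon>) * norm (x - z) \<le> \<tau>0 * (a + l * (\<epsilon> * norm (x - z)))"
        by (rule error_bound_if_excess_le[where g = g and z = z and f = f, OF f_convex bdS[OF z(1)] lip r(2) zr(3) _ a(2) \<epsilon>0
            \<delta>2(2)[OF xb zb(3)] F\<tau>0[OF z(1) zb(2), unfolded F_def] proj]) (use a in auto)
      then have "(1 - \<epsilon> * (1 + \<tau>0 * l)) * norm (x - z) \<le> \<tau>0 * a" by (simp add: algebra_simps)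
      then have "norm (x - z) \<le> \<tau> * a" using \<tau> \<tau>0 by (simp add: \<epsilon>eq field_simps)
      moreover have "z \<in> S" using z(1) closedS by (simp add: frontier_def)
      ultimately have "infdist x S \<le> \<tau> * a" by (intro infdist_le2) (auto simp: dist_norm)
      moreover have "S \<noteq> {}" using \<open>z \<in> S\<close> by auto
      ultimately have "edist_set x S \<le> ereal (\<tau> * a)" by (simp add: edist_set_def)
      then show ?thesis using a by (simp add: S_def)
    qed
    moreover have "\<delta> > 0" using \<rho> \<delta>1 \<delta>2 by (auto simp: \<delta>_def)
    ultimately show ?thesis using \<tau> unfolding error_bound_with_def by blast
  qed
  have eq: "error_bound_modulus (\<lambda>x. f (g x)) xbar = limsup_within (frontier S) xbar F"
  proof (rule antisym)
    show "limsup_within (frontier S) xbar F \<le> error_bound_modulus (\<lambda>x. f (g x)) xbar"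
      unfolding error_bound_modulus_def by (intro Inf_greatest) (use upper in auto)
    show "error_bound_modulus (\<lambda>x. f (g x)) xbar \<le> limsup_within (frontier S) xbar F"
    \<comment> \<open>\<open>lower\<close> needs a real constant strictly above the limit superior,
      so the inequality is tested against all larger \<open>c\<close>.\<close>
    proof (rule dense_ge)
      fix c assume "limsup_within (frontier S) xbar F < c"
      then obtain t where t: "limsup_within (frontier S) xbar F < ereal t" "ereal t < c"
        using ereal_dense2 by blast
      have "error_bound_modulus (\<lambda>x. f (g x)) xbar \<le> ereal t"
        unfolding error_bound_modulus_def using lower[OF t(1)] by (intro Inf_lower) auto
      then show "error_bound_modulus (\<lambda>x. f (g x)) xbar \<le> c" using t(2) by simp
    qed
  qed
  have iff: "has_local_error_bound (\<lambda>x. f (g x)) xbar \<longleftrightarrow> limsup_within (frontier S) xbar F < \<infinity>"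
  proof
    assume "has_local_error_bound (\<lambda>x. f (g x)) xbar"
    then obtain \<tau> where "error_bound_with (\<lambda>x. f (g x)) xbar \<tau>" by (auto simp: has_local_error_bound_def)
    from upper[OF this] show "limsup_within (frontier S) xbar F < \<infinity>" by (auto intro: le_less_trans)
  next
    assume "limsup_within (frontier S) xbar F < \<infinity>"
    then obtain \<tau> where "limsup_within (frontier S) xbar F < ereal \<tau>" using ereal_dense2 by blast
    then show "has_local_error_bound (\<lambda>x. f (g x)) xbar" using lower by (auto simp: has_local_error_bound_def)
  qed
  show ?thesis using iff eq by (simp add: S_def F_def[abs_def])
qed

end
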